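(* Let $n\ge 1$ and $m\ge 2$ be integers. The $n$-$m$ flower process satisfies $$C_\mu^+=1+\tfrac12\log n,\qquad C_\mu^-\le\log(m+1),\qquad D_\mu^+=\log(n+1),\qquad D_\mu^-\le\log(m+1).$$ In particular, for $m=2$ and $n\to\infty$, the quantities $C_\mu^+$, $D_\mu^+$, $|C_\mu^--C_\mu^+|$ and $|D_\mu^--D_\mu^+|$ all diverge to infinity, whereas for $m=2$ and every $n$ the quantum complexities satisfy $$C_q^+,\;C_q^-,\;D_q^+,\;D_q^-\;\le\;\log 3 .$$
   Context: The $n$-$m$ flower process: there are $n$ dice $d_1,\dots,d_n$, each with $m$ sides; die $d_i$ lands on side $j\in\{1,\dots,m\}$ with probability $p^i_j$, the dice having different biases, $p^i_j\ne p^k_j$ for $i\neq k$. One repeatedly does the following, independently each time: select a die $d_i$ uniformly at random and record the output $x_t=i$; then roll it and record the outcome $j$ as $x_{t+1}=j+n$. The process is taken to be stationary (both phases, "select" and "roll", are equally likely at a given time). General definitions. A stochastic process $\mathcal P=P(\overleftarrow X,\overrightarrow X)$ is the law of a bi-infinite sequence $(X_t)_{t\in\mathbb Z}$ of discrete random variables, with past $\overleftarrow X=\dots X_{-2}X_{-1}$ and future $\overrightarrow X=X_0X_1\dots$. The time-reversed process $\mathcal P^-$ is the law of $(Y_t)$ with $Y_t=X_{-(t+1)}$. Logarithms are base 2. Classical complexities: two pasts $\overleftarrow x,\overleftarrow x'$ are equivalent iff $P(\overrightarrow X|\overleftarrow X=\overleftarrow x)=P(\overrightarrow X|\overleftarrow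 X=\overleftarrow x')$. The equivalence classes $\{s_i\}$ are the causal states, and $\pi_i=P(\overleftarrow X\in s_i)$. The classical statistical complexity is $C_\mu^+=-\sum_i\pi_i\log\pi_i$ and the classical topological state complexity $D_\mu^+$ is the logarithm of the number of causal states; $C_\mu^-,D_\mu^-$ are the same quantities for $\mathcal P^-$. Quantum complexities: a quantum (causal) model of $\mathcal P$ is a tuple $\mathcal Q=(f,\Omega,\mathcal M)$, where $\Omega$ is a set of pure states of a physical system $\Xi$, $f$ maps each past $\overleftarrow x$ to a state $f(\overleftarrow x)=|s_{\overleftarrow x}\rangle\in\Omega$, and $\mathcal M$ is a quantum measurement process (quantum instrument) on $\Xi$ such that, for every past $\overleftarrow x$, applying $\mathcal M$ to $\Xi$ in state $f(\overleftarrow x)$ (i) yields output $x$ with probability $P(X_0=x|\overleftarrow X=\overleftarrow x)$, and (ii) then leaves $\Xi$ in state $f(\overleftarrow x x)$, where $\overleftarrow xx$ is the past with $x$ appended. Let $\rho=\sum_{\overleftarrow x}P(\overleftarrow X=\overleftarrow x)|s_{\overleftarrow x}\rangle\langle s_{\overleftarrow x}|$. $C_q^+$ is the minimum of the von Neumann entropy $S(\rho)=-\mathrm{Tr}(\rho\log\rho)$ over all quantum models of $\mathcal P$, and $D_q^+$ is the logarithm of the minimal dimension of a system $\Xi$ needed to model $\mathcal P$, i.e. the minimum of $\log\operatorname{rank}\rho$ over all quantum models; $C_q^-,D_q^-$ are the same quantities for $\mathcal P^-$. *)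

theory Defs
  imports "HOL-Probability.Probability"
begin

section \<open>Stochastic processes, pasts and predictions\<close>

text \<open>
  A process is the law of a bi-infinite sequence over a countable alphabet: a probability
  measure on \<open>int \<Rightarrow> 'a\<close>.
  A past \<open>\<dots> X_{-2} X_{-1}\<close> is stored with the most recent symbol first, so the entry
  at \<open>k\<close> is \<open>X_{-(k+1)}\<close>, and appending the symbol \<open>x\<close> to the past \<open>h\<close> gives
  \<open>case_nat x h\<close>.
\<close>

abbreviation path_space :: "('t \<Rightarrow> 'a) measure" where
  "path_space \<equiv> PiM UNIV (\<lambda>_. count_space UNIV)"

definition reverse_process :: "(int \<Rightarrow> 'a::countable) measure \<Rightarrow> (int \<Rightarrow> 'a) measure" where
  "reverse_process M = distr M path_space (\<lambda>\<omega> t. \<omega> (- (t + 1)))"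

definition past_law :: "(int \<Rightarrow> 'a::countable) measure \<Rightarrow> (nat \<Rightarrow> 'a) measure" where
  "past_law M = distr M path_space (\<lambda>\<omega> k. \<omega> (- (int k + 1)))"

text \<open>Probability that the last \<open>L\<close> past symbols are those of \<open>h\<close> and that the future
  starts with the word \<open>w\<close>.\<close>

definition joint_prob :: "(int \<Rightarrow> 'a::countable) measure \<Rightarrow> (nat \<Rightarrow> 'a) \<Rightarrow> nat \<Rightarrow> 'a list \<Rightarrow> real" where
  "joint_prob M h L w = measure M {\<omega> \<in> space M.
     (\<forall>k<L. \<omega> (- (int k + 1)) = h k) \<and> (\<forall>k<length w. \<omega> (int k) = w ! k)}"

text \<open>
  A single infinite past usually has probability zero. Conditioning on it means
  conditioning on its last \<open>L\<close> symbols and letting \<open>L\<close> tend to infinity. By Levy's upward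
  theorem the limits exist for almost every past and form a version of the conditional
  distribution of the future given the past. The pasts of the process are those for which
  all these conditional probabilities and their limits are defined.
\<close>

definition pasts :: "(int \<Rightarrow> 'a::countable) measure \<Rightarrow> (nat \<Rightarrow> 'a) set" where
  "pasts M = {h. (\<forall>L. joint_prob M h L [] > 0) \<and>
     (\<forall>w. convergent (\<lambda>L. joint_prob M h L w / joint_prob M h L []))}"

definition future_prob :: "(int \<Rightarrow> 'a::countable) measure \<Rightarrow> (nat \<Rightarrow> 'a) \<Rightarrow> 'a list \<Rightarrow> real" where
  "future_prob M h w = lim (\<lambda>L. joint_prob M h L w / joint_prob M h L [])"


section \<open>Classical complexities\<close>

definition causal_rel :: "(int \<Rightarrow> 'a::countable) measure \<Rightarrow> ((nat \<Rightarrow> 'a) \<times> (nat \<Rightarrow> 'a)) set" where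
  "causal_rel M = {(h, h'). h \<in> pasts M \<and> h' \<in> pasts M \<and>
     (\<forall>w. future_prob M h w = future_prob M h' w)}"

definition causal_states :: "(int \<Rightarrow> 'a::countable) measure \<Rightarrow> (nat \<Rightarrow> 'a) set set" where
  "causal_states M = pasts M // causal_rel M"

definition entropy_sum :: "('i \<Rightarrow> real) \<Rightarrow> 'i set \<Rightarrow> ereal" where
  "entropy_sum q A = (\<Sum>\<^sub>\<infinity>i\<in>A. ereal (- (q i * log 2 (q i))))"

definition elog2 :: "enat \<Rightarrow> ereal" where
  "elog2 N = (case N of enat k \<Rightarrow> ereal (log 2 (real k)) | \<infinity> \<Rightarrow> \<infinity>)"

text \<open>If the causal states do not carry the whole mass as atoms (a continuum of states),
  the statistical complexity is infinite.\<close>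

definition C_mu :: "(int \<Rightarrow> 'a::countable) measure \<Rightarrow> ereal" where
  "C_mu M = (let q = measure (past_law M) in
     if (q has_sum 1) (causal_states M) then entropy_sum q (causal_states M) else \<infinity>)"

definition D_mu :: "(int \<Rightarrow> 'a::countable) measure \<Rightarrow> ereal" where
  "D_mu M = elog2 (if finite (causal_states M) then enat (card (causal_states M)) else \<infinity>)"


section \<open>Quantum models\<close>

text \<open>
  A system of dimension \<open>d\<close>, finite or countably infinite, has the Hilbert space
  of square-summable sequences supported on the indices below \<open>d\<close>.
\<close>

type_synonym cvec = "nat \<Rightarrow> complex"

definition idx :: "enat \<Rightarrow> nat set" where
  "idx d = {i. enat i < d}"

definition hilb :: "enat \<Rightarrow> cvec set" where
  "hilb d = {\<psi>. (\<forall>i. i \<notin> idx d \<longrightarrow> \<psi> i = 0) \<and> (\<lambda>i. (cmod (\<psi> i))\<^sup>2) summable_on idx d}"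

definition qinner :: "enat \<Rightarrow> cvec \<Rightarrow> cvec \<Rightarrow> complex" where
  "qinner d \<phi> \<psi> = (\<Sum>\<^sub>\<infinity>i\<in>idx d. cnj (\<phi> i) * \<psi> i)"

definition norm_sq :: "enat \<Rightarrow> cvec \<Rightarrow> real" where
  "norm_sq d \<psi> = (\<Sum>\<^sub>\<infinity>i\<in>idx d. (cmod (\<psi> i))\<^sup>2)"

definition linear_op :: "enat \<Rightarrow> (cvec \<Rightarrow> cvec) \<Rightarrow> bool" where
  "linear_op d T \<longleftrightarrow> (\<forall>\<psi>\<in>hilb d. T \<psi> \<in> hilb d) \<and>
     (\<forall>\<phi>\<in>hilb d. \<forall>\<psi>\<in>hilb d. \<forall>a b.
        T (\<lambda>i. a * \<phi> i + b * \<psi> i) = (\<lambda>i. a * T \<phi> i + b * T \<psi> i))"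

text \<open>
  A quantum instrument with outcomes in \<open>'a\<close>, in operator-sum form: outcome \<open>x\<close>
  maps a state \<open>\<sigma>\<close> to \<open>\<Sum>k. K x k \<sigma> (K x k)\<^sup>*\<close>. The norm condition is trace
  preservation, i.e. \<open>\<Sum>x k. (K x k)\<^sup>* (K x k) = 1\<close>. It also makes each \<open>K x k\<close> bounded.
\<close>

definition instrument :: "enat \<Rightarrow> ('a \<Rightarrow> nat \<Rightarrow> cvec \<Rightarrow> cvec) \<Rightarrow> bool" where
  "instrument d K \<longleftrightarrow> (\<forall>x k. linear_op d (K x k)) \<and>
     (\<forall>\<psi>\<in>hilb d. ((\<lambda>(x, k). norm_sq d (K x k \<psi>)) has_sum norm_sq d \<psi>) UNIV)"

definition outcome_prob :: "enat \<Rightarrow> ('a \<Rightarrow> nat \<Rightarrow> cvec \<Rightarrow> cvec) \<Rightarrow> 'a \<Rightarrow> cvec \<Rightarrow> real" where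
  "outcome_prob d K x \<psi> = (\<Sum>\<^sub>\<infinity>k. norm_sq d (K x k \<psi>))"

definition post_state ::
    "enat \<Rightarrow> ('a \<Rightarrow> nat \<Rightarrow> cvec \<Rightarrow> cvec) \<Rightarrow> 'a \<Rightarrow> cvec \<Rightarrow> nat \<Rightarrow> nat \<Rightarrow> complex" where
  "post_state d K x \<psi> i j =
     (\<Sum>\<^sub>\<infinity>k. K x k \<psi> i * cnj (K x k \<psi> j)) / complex_of_real (outcome_prob d K x \<psi>)"

text \<open>
  Pure states are unit vectors, and they are compared through their projectors, so global
  phases play no role. The state after outcome \<open>x\<close> is constrained only if \<open>x\<close> can occur.
  Measurability of \<open>f\<close> is what makes the average state of the memory meaningful.
\<close>

definition quantum_model :: "(int \<Rightarrow> 'a::countable) measure \<Rightarrow> enat \<Rightarrow>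
    ((nat \<Rightarrow> 'a) \<Rightarrow> cvec) \<Rightarrow> cvec set \<Rightarrow> ('a \<Rightarrow> nat \<Rightarrow> cvec \<Rightarrow> cvec) \<Rightarrow> bool" where
  "quantum_model M d f \<Omega> K \<longleftrightarrow>
     \<Omega> \<subseteq> {\<psi> \<in> hilb d. norm_sq d \<psi> = 1} \<and>
     (\<forall>h\<in>pasts M. f h \<in> \<Omega>) \<and>
     (\<forall>i. (\<lambda>h. f h i) \<in> borel_measurable (past_law M)) \<and>
     instrument d K \<and>
     (\<forall>h\<in>pasts M. \<forall>x.
        outcome_prob d K x (f h) = future_prob M h [x] \<and>
        (future_prob M h [x] > 0 \<longrightarrow>
          (\<forall>i\<in>idx d. \<forall>j\<in>idx d. post_state d K x (f h) i j
             = f (case_nat x h) i * cnj (f (case_nat x h) j))))"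

definition memory_state ::
    "(int \<Rightarrow> 'a::countable) measure \<Rightarrow> ((nat \<Rightarrow> 'a) \<Rightarrow> cvec) \<Rightarrow> nat \<Rightarrow> nat \<Rightarrow> complex" where
  "memory_state M f i j = (LINT h|past_law M. f h i * cnj (f h j))"

text \<open>\<open>\<rho> = \<Sum>k\<in>A. q k |e k\<rangle>\<langle>e k|\<close> with \<open>e\<close> orthonormal and \<open>q\<close> the nonzero eigenvalues,
  repeated according to multiplicity.\<close>

definition spectral_decomposition ::
    "enat \<Rightarrow> (nat \<Rightarrow> nat \<Rightarrow> complex) \<Rightarrow> nat set \<Rightarrow> (nat \<Rightarrow> real) \<Rightarrow> (nat \<Rightarrow> cvec) \<Rightarrow> bool" where
  "spectral_decomposition d \<rho> A q e \<longleftrightarrow>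
     (\<forall>k\<in>A. q k > 0 \<and> e k \<in> hilb d) \<and>
     (\<forall>k\<in>A. \<forall>l\<in>A. qinner d (e k) (e l) = (if k = l then 1 else 0)) \<and>
     (\<forall>i\<in>idx d. \<forall>j\<in>idx d.
        ((\<lambda>k. complex_of_real (q k) * e k i * cnj (e k j)) has_sum \<rho> i j) A)"

text \<open>\<open>-Tr(\<rho> log \<rho>)\<close>, evaluated in an eigenbasis. A density operator has a spectral
  decomposition, and the value does not depend on which one is chosen.\<close>

definition vn_entropy :: "enat \<Rightarrow> (nat \<Rightarrow> nat \<Rightarrow> complex) \<Rightarrow> ereal" where
  "vn_entropy d \<rho> =
     (SOME s. \<exists>A q e. spectral_decomposition d \<rho> A q e \<and> s = entropy_sum q A)"

text \<open>The rank is the dimension of the range: the least size of a finite set of vectors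
  whose linear span contains the range, and infinity if there is none.\<close>

definition op_range :: "enat \<Rightarrow> (nat \<Rightarrow> nat \<Rightarrow> complex) \<Rightarrow> cvec set" where
  "op_range d \<rho> = (\<lambda>\<psi> i. if i \<in> idx d then (\<Sum>\<^sub>\<infinity>j\<in>idx d. \<rho> i j * \<psi> j) else 0) ` hilb d"

definition op_rank :: "enat \<Rightarrow> (nat \<Rightarrow> nat \<Rightarrow> complex) \<Rightarrow> enat" where
  "op_rank d \<rho> = (INF B \<in> {B. finite B \<and>
     (\<forall>v\<in>op_range d \<rho>. \<exists>c. v = (\<lambda>i. \<Sum>b\<in>B. c b * b i))}. enat (card B))"

definition C_q :: "(int \<Rightarrow> 'a::countable) measure \<Rightarrow> ereal" where
  "C_q M = Inf {vn_entropy d (memory_state M f) | d f \<Omega> K. quantum_model M d f \<Omega> K}"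

definition D_q :: "(int \<Rightarrow> 'a::countable) measure \<Rightarrow> ereal" where
  "D_q M = Inf {elog2 (op_rank d (memory_state M f)) | d f \<Omega> K. quantum_model M d f \<Omega> K}"


section \<open>The flower process\<close>

text \<open>\<open>p i\<close> is the law of die \<open>i\<close>: the probability of side \<open>j\<close> is \<open>pmf (p i) j\<close>.\<close>

definition biased_dice :: "nat \<Rightarrow> nat \<Rightarrow> (nat \<Rightarrow> nat pmf) \<Rightarrow> bool" where
  "biased_dice n m p \<longleftrightarrow>
     (\<forall>i\<in>{1..n}. set_pmf (p i) \<subseteq> {1..m}) \<and>
     (\<forall>i\<in>{1..n}. \<forall>k\<in>{1..n}. i \<noteq> k \<longrightarrow> (\<exists>j\<in>{1..m}. pmf (p i) j \<noteq> pmf (p k) j))"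

definition select_and_roll :: "nat \<Rightarrow> (nat \<Rightarrow> nat pmf) \<Rightarrow> (nat \<times> nat) pmf" where
  "select_and_roll n p =
     bind_pmf (pmf_of_set {1..n}) (\<lambda>i. map_pmf (\<lambda>j. (i, j)) (p i))"

text \<open>An i.i.d. sequence of rounds (selected die, outcome) is laid out along the integers,
  two time steps per round. A fair coin decides whether dice are selected at even or at
  odd times, which makes the process stationary.\<close>

definition flower :: "nat \<Rightarrow> (nat \<Rightarrow> nat pmf) \<Rightarrow> (int \<Rightarrow> nat) measure" where
  "flower n p = distr
     (measure_pmf (bernoulli_pmf (1/2)) \<Otimes>\<^sub>M
        PiM (UNIV :: int set) (\<lambda>_. measure_pmf (select_and_roll n p)))
     path_space
     (\<lambda>(b, r) t. let u = t + of_bool b in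
        if even u then fst (r (u div 2)) else snd (r (u div 2)) + n)"

end

theory Submission
  imports Defs "HOL-Real_Asymp.Real_Asymp"
begin

text \<open>
  The flower process is a stationary Markov chain on the symbols: after die \<open>i\<close> comes an
  outcome of that die, after any outcome comes a uniform die. Hence conditioning on a past only
  retains its last symbol, and the causal states correspond to the distinct rows of the transition
  kernel: one for each die and one for all outcomes together. Detailed balance gives the kernel of
  the reversed chain, in which all dice have the same row (the average law of an outcome), so at
  most \<open>m + 1\<close> rows remain.

  If every row of the kernel is a mixture \<open>T y = (\<Sum>k<d. G y k\<^sup>2 W k)\<close> of \<open>d\<close> fixed laws, then
  encoding a past ending in \<open>y\<close> as the vector \<open>G y\<close>, measuring it in the computational basis,
  outputting \<open>x\<close> with law \<open>W k\<close> and preparing \<open>G x\<close> is a quantum model of dimension \<open>d\<close>. For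
  coins \<open>d = 3\<close> suffices in both directions of time: forwards the laws are the uniform die and
  the two deterministic outcomes, backwards they are the three rows themselves.
\<close>

section \<open>Path probabilities and entropy\<close>

fun path_prob :: "('a \<Rightarrow> 'a pmf) \<Rightarrow> 'a \<Rightarrow> 'a list \<Rightarrow> real" where
  "path_prob T x [] = 1"
| "path_prob T x (y # v) = pmf (T x) y * path_prob T y v"

lemma path_prob_append:
  "path_prob T x (v @ w) = path_prob T x v * path_prob T (last (x # v)) w"
  by (induction v arbitrary: x) auto

text \<open>One-letter words already determine a row. This reduces equality of all conditional
  futures to equality of rows of the kernel.\<close>

lemma path_prob_eq_iff: "path_prob T x = path_prob T y \<longleftrightarrow> T x = T y"
proof
  assume eq: "path_prob T x = path_prob T y"
  show "T x = T y"
  proof (rule pmf_eqI)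
    fix z show "pmf (T x) z = pmf (T y) z"
      using fun_cong[OF eq, of "[z]"] by simp
  qed
next
  assume "T x = T y"
  then have "path_prob T x w = path_prob T y w" for w
    by (cases w) auto
  then show "path_prob T x = path_prob T y" ..
qed

text \<open>Gibbs' inequality against the uniform law on \<open>N\<close> points:
  \<open>ln t <= t - 1\<close> at \<open>t = 1 / (q i * N)\<close>, weighted by \<open>q i\<close>
  and summed. Only \<open>card A <= N\<close> is assumed, so an upper bound on the number of states
  is enough later.\<close>

lemma entropy_le_log_card:
  fixes q :: "'i \<Rightarrow> real"
  assumes fin: "finite A" and card: "card A \<le> N"
    and q: "\<And>i. i \<in> A \<Longrightarrow> q i \<ge> 0" and sum: "sum q A = 1"
  shows "(\<Sum>i\<in>A. - (q i * log 2 (q i))) \<le> log 2 (real N)"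
proof -
  have "A \<noteq> {}" using sum by auto
  with fin card have N: "real N > 0" by (metis card_gt_0_iff less_le_trans of_nat_0_less_iff)
  have *: "- (q i * ln (q i)) - q i * ln (real N) \<le> 1 / real N - q i" if "i \<in> A" for i
  proof (cases "q i = 0")
    case False
    with q[OF that] have qi: "q i > 0" by simp
    have "- ln (q i) - ln (real N) = ln (1 / (q i * real N))"
      using qi N by (simp add: ln_div ln_mult)
    also have "\<dots> \<le> 1 / (q i * real N) - 1"
      using qi N by (intro ln_le_minus_one) simp
    finally have "q i * (- ln (q i) - ln (real N)) \<le> q i * (1 / (q i * real N) - 1)"
      using qi by (intro mult_left_mono) auto
    also have "\<dots> = 1 / real N - q i" using qi by (simp add: field_simps)
    finally show ?thesis by (simp add: algebra_simps)
  qed (use N in auto)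
  have "(\<Sum>i\<in>A. - (q i * ln (q i))) - ln (real N) = (\<Sum>i\<in>A. - (q i * ln (q i)) - q i * ln (real N))"
    unfolding sum_subtractf by (simp add: sum_distrib_right[symmetric] sum)
  also have "\<dots> \<le> (\<Sum>i\<in>A. 1 / real N - q i)" by (rule sum_mono) (rule *)
  also have "\<dots> = real (card A) / real N - 1" by (simp add: sum_subtractf sum)
  also have "\<dots> \<le> 0" using card N by (simp add: divide_le_eq)
  finally have "(\<Sum>i\<in>A. - (q i * ln (q i))) \<le> ln (real N)" by simp
  moreover have "(\<Sum>i\<in>A. - (q i * log 2 (q i))) = (\<Sum>i\<in>A. - (q i * ln (q i))) / ln 2"
    by (simp add: log_def sum_divide_distrib)
  ultimately show ?thesis by (simp add: log_def divide_right_mono)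
qed

lemma entropy_sum_finite:
  assumes "finite A"
  shows "entropy_sum q A = ereal (\<Sum>i\<in>A. - (q i * log 2 (q i)))"
  unfolding entropy_sum_def using assms by simp

lemma elog2_mono: assumes "M \<le> N" shows "elog2 M \<le> elog2 N"
proof (cases N)
  case (enat k)
  then obtain l where l: "M = enat l" using assms by (metis enat_ile)
  have "log 2 (real l) \<le> log 2 (real k)"
  \<comment> \<open>By convention \<open>log 2 0 = 0\<close>, so the only new inequality here is
    \<open>0 <= log 2 k\<close> for \<open>k >= 1\<close>.\<close>
  proof (cases "l = 0 \<or> k = 0")
    case True
    then show ?thesis using assms l enat by (cases "k = 0") (auto simp: log_def)
  qed (use assms l enat in auto)
  then show ?thesis by (simp add: elog2_def l enat)
qed (simp add: elog2_def)

lemma path_prob_nonneg: "path_prob T x v \<ge> 0"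
  by (induction v arbitrary: x) auto

section \<open>Stationary Markov processes\<close>

text \<open>The word probabilities do not depend on the position \<open>a\<close>; this encodes
  stationarity. A row \<open>T x\<close> with \<open>\<pi> x = 0\<close> is unconstrained, which
  leaves room for default rows.\<close>

locale markov_process = prob_space M
  for M :: "(int \<Rightarrow> 'a::countable) measure" and \<pi> :: "'a \<Rightarrow> real" and T :: "'a \<Rightarrow> 'a pmf" +
  assumes sets_M: "sets M = sets path_space"
    and prob_window: "\<And>a x v. measure M {\<omega> \<in> space M. \<forall>k<length (x # v). \<omega> (a + int k) = (x # v) ! k}
      = \<pi> x * path_prob T x v"
begin

text \<open>Past and future together form a single window of the chain, and its path probability
  factorizes at the most recent symbol \<open>h 0\<close>.\<close>

lemma joint_prob_Suc:
  "joint_prob M h (Suc L) w =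
     \<pi> (h L) * path_prob T (h L) (map h (rev [0..<L])) * path_prob T (h 0) w"
proof -
  \<comment> \<open>The past is stored with the newest symbol first; \<open>v\<close> lists it
    chronologically, starting at time \<open>-(L + 1)\<close>.\<close>
  define v where "v = map h (rev [0..<Suc L])"
  have v: "v = h L # map h (rev [0..<L])" by (simp add: v_def)
  have len: "length v = Suc L" by (simp add: v_def)
  have nth: "v ! k = h (L - k)" if "k < Suc L" for k
    using that unfolding v_def by (simp add: nth_map rev_nth del: upt_Suc)
  have "(\<forall>k<Suc L. \<omega> (- (int k + 1)) = h k) \<and> (\<forall>k<length w. \<omega> (int k) = w ! k) \<longleftrightarrow>
      (\<forall>k<length (v @ w). \<omega> (- int (Suc L) + int k) = (v @ w) ! k)" (is "?l \<longleftrightarrow> ?r") for \<omega> :: "int \<Rightarrow> 'a"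
  proof safe
    fix k assume l: "\<forall>k<Suc L. \<omega> (- (int k + 1)) = h k" "\<forall>k<length w. \<omega> (int k) = w ! k"
      and k: "k < length (v @ w)"
    show "\<omega> (- int (Suc L) + int k) = (v @ w) ! k"
    proof (cases "k < Suc L")
      case True
      then have *: "- int (Suc L) + int k = - (int (L - k) + 1)" by auto
      show ?thesis unfolding * using l(1)[rule_format, of "L - k"] True
        by (simp add: nth_append len nth algebra_simps)
    next
      case False
      then have *: "- int (Suc L) + int k = int (k - Suc L)" by auto
      have "\<omega> (int (k - Suc L)) = w ! (k - Suc L)"
        by (rule l(2)[rule_format]) (use False k in \<open>auto simp: len\<close>)
      then show ?thesis unfolding * by (simp only: nth_append len False if_False)
    qed
  next
    fix k assume r: ?r and k: "k < Suc L"
    have *: "- int (Suc L) + int (L - k) = - (int k + 1)" using k by auto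
    show "\<omega> (- (int k + 1)) = h k"
      using r[rule_format, of "L - k", unfolded *] k by (auto simp: nth_append len nth)
  next
    fix k assume r: ?r and k: "k < length w"
    have *: "- int (Suc L) + int (Suc L + k) = int k" by auto
    show "\<omega> (int k) = w ! k"
      using r[rule_format, of "Suc L + k", unfolded *] k by (auto simp: nth_append len)
  qed
  then have "joint_prob M h (Suc L) w =
      measure M {\<omega> \<in> space M. \<forall>k<length (v @ w). \<omega> (- int (Suc L) + int k) = (v @ w) ! k}"
    unfolding joint_prob_def by simp
  also have "\<dots> = \<pi> (h L) * path_prob T (h L) (map h (rev [0..<L]) @ w)"
    using prob_window[of "h L" "map h (rev [0..<L]) @ w" "- int (Suc L)"] by (simp add: v)
  also have "last (h L # map h (rev [0..<L])) = h 0"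
    by (cases L) (auto simp: last_map last_rev upt_rec[of 0] simp del: upt_Suc)
  then have "path_prob T (h L) (map h (rev [0..<L]) @ w) =
      path_prob T (h L) (map h (rev [0..<L])) * path_prob T (h 0) w"
    by (simp only: path_prob_append)
  finally show ?thesis by simp
qed

lemma joint_prob_ratio:
  assumes "joint_prob M h (Suc L) [] > 0"
  shows "joint_prob M h (Suc L) w / joint_prob M h (Suc L) [] = path_prob T (h 0) w"
  using assms by (auto simp: joint_prob_Suc)

text \<open>From conditioning length one on the ratio is constant: all factors of the past cancel
  and only its last symbol survives.\<close>

lemma joint_prob_limit:
  assumes "\<forall>L. joint_prob M h L [] > 0"
  shows "(\<lambda>L. joint_prob M h L w / joint_prob M h L []) \<longlonglongrightarrow> path_prob T (h 0) w"
  by (rule LIMSEQ_imp_Suc) (simp add: joint_prob_ratio assms)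

lemma pasts_eq: "pasts M = {h. \<forall>L. joint_prob M h L [] > 0}"
  unfolding pasts_def using joint_prob_limit by (auto simp: convergent_def)

lemma future_prob_eq: "h \<in> pasts M \<Longrightarrow> future_prob M h w = path_prob T (h 0) w"
  unfolding future_prob_def pasts_eq using joint_prob_limit by (auto intro: limI)

section \<open>The law of the past and its null set of excluded pasts\<close>

lemma sets_past_law [measurable_cong]: "sets (past_law M) = sets path_space"
  by (simp add: past_law_def)

lemma space_past_law: "space (past_law M) = UNIV"
  by (simp add: past_law_def space_PiM)

lemma measurable_past: "(\<lambda>\<omega> k. \<omega> (- (int k + 1))) \<in> M \<rightarrow>\<^sub>M path_space"
  unfolding measurable_cong_sets[OF sets_M refl]
  by (rule measurable_PiM_single') (auto simp: space_PiM)

sublocale past: prob_space "past_law M"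
  unfolding past_law_def by (rule prob_space_distr) (rule measurable_past)

lemma measurable_prefix:
  "{h :: nat \<Rightarrow> 'a. \<forall>k<L. h k = g k} \<in> sets path_space"
proof -
  have "{h \<in> space (path_space :: (nat \<Rightarrow> 'a) measure). \<forall>k<L. h k = g k} \<in> sets path_space"
    by measurable
  then show ?thesis by (simp add: space_PiM)
qed

lemma past_prefix: "measure (past_law M) {h. \<forall>k<L. h k = g k} = joint_prob M g L []"
  unfolding past_law_def joint_prob_def
  by (subst measure_distr[OF measurable_past measurable_prefix])
     (auto intro!: arg_cong[where f = "measure M"])

lemma joint_prob_cong:
  assumes "\<And>k. k < L \<Longrightarrow> h k = h' k" shows "joint_prob M h L w = joint_prob M h' L w"
  unfolding joint_prob_def using assms by simp

text \<open>An excluded past has a finite prefix of probability zero. Words over a countable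
  alphabet are countable, so this writes the excluded pasts as a countable union of null cylinders.
  Entries of \<open>(!) v\<close> beyond the length of \<open>v\<close> are never inspected.\<close>

lemma compl_pasts_eq:
  "- pasts M = (\<Union>v\<in>{v. joint_prob M ((!) v) (length v) [] = 0}. {h. \<forall>k<length v. h k = v ! k})"
proof -
  have "h \<notin> pasts M \<longleftrightarrow> (\<exists>L. joint_prob M h L [] = 0)" for h
    unfolding pasts_eq using zero_less_measure_iff by (auto simp: joint_prob_def)
  moreover have "(\<exists>L. joint_prob M h L [] = 0) \<longleftrightarrow>
      (\<exists>v. joint_prob M ((!) v) (length v) [] = 0 \<and> (\<forall>k<length v. h k = v ! k))" for h
  proof
    assume "\<exists>L. joint_prob M h L [] = 0"
    then obtain L where L: "joint_prob M h L [] = 0" ..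
    have "joint_prob M ((!) (map h [0..<L])) L [] = joint_prob M h L []"
      by (rule joint_prob_cong) simp
    with L show "\<exists>v. joint_prob M ((!) v) (length v) [] = 0 \<and> (\<forall>k<length v. h k = v ! k)"
      by (intro exI[of _ "map h [0..<L]"]) simp
  next
    assume "\<exists>v. joint_prob M ((!) v) (length v) [] = 0 \<and> (\<forall>k<length v. h k = v ! k)"
    then obtain v where v: "joint_prob M ((!) v) (length v) [] = 0" "\<forall>k<length v. h k = v ! k"
      by blast
    have "joint_prob M h (length v) [] = joint_prob M ((!) v) (length v) []"
      by (rule joint_prob_cong) (use v in simp)
    with v show "\<exists>L. joint_prob M h L [] = 0" by metis
  qed
  ultimately show ?thesis by blast
qed

lemma compl_pasts_null: "- pasts M \<in> null_sets (past_law M)"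
  unfolding compl_pasts_eq
proof (rule null_sets_UN')
  fix v :: "'a list" assume "v \<in> {v. joint_prob M ((!) v) (length v) [] = 0}"
  then have "measure (past_law M) {h. \<forall>k<length v. h k = v ! k} = 0"
    by (simp add: past_prefix)
  then show "{h. \<forall>k<length v. h k = v ! k} \<in> null_sets (past_law M)"
    using measurable_prefix[of "length v" "(!) v"]
    by (auto simp: null_sets_def sets_past_law past.emeasure_eq_measure)
qed simp

lemma sets_pasts [measurable]: "pasts M \<in> sets (past_law M)"
  using sets.compl_sets[of "- pasts M" "past_law M"] compl_pasts_null
  by (auto simp: space_past_law null_sets_def Compl_eq_Diff_UNIV[symmetric])

lemma measure_pasts: "measure (past_law M) (pasts M) = 1"
proof -
  have "measure (past_law M) (- pasts M) = 0"
    using compl_pasts_null by (auto simp: null_sets_def measure_def)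
  then show ?thesis
    using past.prob_compl[of "pasts M"] sets_pasts by (simp add: space_past_law Compl_eq_Diff_UNIV[symmetric])
qed

section \<open>Causal states as fibres of the transition kernel\<close>

definition state_of :: "'a pmf \<Rightarrow> (nat \<Rightarrow> 'a) set" where
  "state_of \<kappa> = {h \<in> pasts M. T (h 0) = \<kappa>}"

lemma sets_last_symbol: "{h. P (h 0)} \<in> sets (past_law M)"
proof -
  have "{h \<in> space (path_space :: (nat \<Rightarrow> 'a) measure). P (h 0)} \<in> sets path_space"
    by measurable
  then show ?thesis by (simp add: space_PiM sets_past_law)
qed

lemma sets_state_of: "state_of \<kappa> \<in> sets (past_law M)"
proof -
  have "state_of \<kappa> = pasts M \<inter> {h. T (h 0) = \<kappa>}" by (auto simp: state_of_def)
  then show ?thesis using sets_last_symbol sets_pasts by simp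
qed

text \<open>Up to the null set of excluded pasts, this event is the cylinder of length one.\<close>

lemma measure_past_symbol: "measure (past_law M) {h \<in> pasts M. h 0 = x} = \<pi> x"
proof -
  have "measure (past_law M) {h \<in> pasts M. h 0 = x} = measure (past_law M) {h. \<forall>k<Suc 0. h k = x}"
  proof (rule measure_eq_AE)
    show "AE h in past_law M. h \<in> {h \<in> pasts M. h 0 = x} \<longleftrightarrow> h \<in> {h. \<forall>k<Suc 0. h k = x}"
      using compl_pasts_null by (intro AE_I'[of "- pasts M"]) auto
    have "{h \<in> pasts M. h 0 = x} = pasts M \<inter> {h. h 0 = x}" by auto
    then show "{h \<in> pasts M. h 0 = x} \<in> sets (past_law M)"
      using sets_last_symbol sets_pasts by simp
    show "{h. \<forall>k<Suc 0. h k = x} \<in> sets (past_law M)"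
      using sets_last_symbol[of "\<lambda>y. y = x"] by simp
  qed
  also have "\<dots> = \<pi> x" by (subst past_prefix) (simp add: joint_prob_Suc)
  finally show ?thesis .
qed

lemma initial_pos: "h \<in> pasts M \<Longrightarrow> \<pi> (h 0) > 0"
  unfolding pasts_eq using joint_prob_Suc[of h 0 "[]"] by (auto dest: spec[of _ "Suc 0"])

text \<open>The class of a past depends only on the row of its last symbol. The last symbols that
  occur are those of positive weight: positive weight gives an event of positive measure, hence a
  past, and conversely the prefix of length one of a past has positive probability.\<close>

lemma causal_states_eq: "causal_states M = state_of ` T ` {x. \<pi> x > 0}"
proof -
  have cls: "causal_rel M `` {h} = state_of (T (h 0))" if "h \<in> pasts M" for h
    using that unfolding causal_rel_def state_of_def
    by (auto simp: future_prob_eq fun_eq_iff simp flip: path_prob_eq_iff)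
  have ex: "\<exists>h\<in>pasts M. h 0 = x" if "\<pi> x > 0" for x
  proof -
    from that measure_past_symbol[of x] have "{h \<in> pasts M. h 0 = x} \<noteq> {}"
      by (metis measure_empty less_irrefl)
    then show ?thesis by auto
  qed
  have "causal_states M = (\<lambda>h. state_of (T (h 0))) ` pasts M"
    unfolding causal_states_def quotient_def using cls by auto
  also have "\<dots> = state_of ` T ` (\<lambda>h. h 0) ` pasts M" by (simp add: image_image)
  also have "(\<lambda>h. h 0) ` pasts M = {x. \<pi> x > 0}" using ex initial_pos by force
  finally show ?thesis .
qed

lemma Union_causal_states: "\<Union> (causal_states M) = pasts M"
  unfolding causal_states_eq state_of_def using initial_pos by auto

lemma disjoint_causal_states: "disjoint (causal_states M)"
  unfolding causal_states_eq state_of_def disjoint_def by auto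

lemma inj_state_of: "inj_on state_of (T ` {x. \<pi> x > 0})"
proof (rule inj_onI, clarify)
  fix x y assume x: "\<pi> x > 0" and eq: "state_of (T x) = state_of (T y)"
  from x measure_past_symbol[of x] have "{h \<in> pasts M. h 0 = x} \<noteq> {}"
    by (metis measure_empty less_irrefl)
  then obtain h where "h \<in> state_of (T x)" "h 0 = x" by (auto simp: state_of_def)
  then show "T x = T y" using eq by (auto simp: state_of_def)
qed

lemma sum_causal_states:
  assumes "finite (causal_states M)"
  shows "sum (measure (past_law M)) (causal_states M) = 1"
proof -
  have "measure (past_law M) (\<Union>A\<in>causal_states M. A) = sum (measure (past_law M)) (causal_states M)"
    using assms disjoint_causal_states
    by (intro past.finite_measure_finite_Union)
       (auto simp: causal_states_eq sets_state_of disjoint_family_on_def disjoint_def)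
  then show ?thesis by (simp add: Union_causal_states measure_pasts)
qed

lemma C_mu_eq:
  assumes "finite (causal_states M)"
  shows "C_mu M = ereal (\<Sum>A\<in>causal_states M.
    - (measure (past_law M) A * log 2 (measure (past_law M) A)))"
proof -
  have "(measure (past_law M) has_sum 1) (causal_states M)"
    using has_sum_finite[OF assms] sum_causal_states[OF assms] by metis
  then show ?thesis by (simp add: C_mu_def Let_def entropy_sum_finite[OF assms])
qed

lemma causal_states_nonempty: "causal_states M \<noteq> {}"
  using Union_causal_states measure_pasts by auto

text \<open>This and \<open>C_mu_nonneg\<close> supply the lower bounds with which the differences
  between the two time directions are later controlled.\<close>

lemma D_mu_nonneg: "D_mu M \<ge> 0"
  using causal_states_nonempty
  by (auto simp: D_mu_def elog2_def card_gt_0_iff Suc_leI zero_le_log_cancel_iff)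

lemma C_mu_nonneg: "C_mu M \<ge> 0"
proof (cases "(measure (past_law M) has_sum 1) (causal_states M)")
  case True
  have "measure (past_law M) A * log 2 (measure (past_law M) A) \<le> 0" for A
    by (cases "measure (past_law M) A = 0")
      (auto intro!: mult_nonneg_nonpos simp: log_le_zero_cancel_iff zero_less_measure_iff)
  then show ?thesis
    using True by (simp add: C_mu_def Let_def entropy_sum_def infsum_nonneg)
qed (simp add: C_mu_def)

lemma C_mu_le_log:
  assumes fin: "finite (T ` {x. \<pi> x > 0})" and card: "card (T ` {x. \<pi> x > 0}) \<le> N"
  shows "C_mu M \<le> ereal (log 2 (real N))" "D_mu M \<le> ereal (log 2 (real N))"
proof -
  have fin': "finite (causal_states M)" using fin by (simp add: causal_states_eq)
  have card': "card (causal_states M) \<le> N"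
    using card by (simp add: causal_states_eq card_image[OF inj_state_of])
  show "C_mu M \<le> ereal (log 2 (real N))"
    unfolding C_mu_eq[OF fin'] ereal_less_eq
    by (rule entropy_le_log_card[OF fin' card']) (auto simp: sum_causal_states[OF fin'])
  show "D_mu M \<le> ereal (log 2 (real N))"
    using elog2_mono[of "enat (card (causal_states M))" "enat N"] card' fin'
    by (simp add: D_mu_def elog2_def)
qed

end

section \<open>Time reversal of a stationary chain\<close>

fun chain_prob :: "('a \<Rightarrow> real) \<Rightarrow> ('a \<Rightarrow> 'a pmf) \<Rightarrow> 'a list \<Rightarrow> real" where
  "chain_prob \<pi> T [] = 1"
| "chain_prob \<pi> T (x # v) = \<pi> x * path_prob T x v"

lemma chain_prob_snoc:
  "v \<noteq> [] \<Longrightarrow> chain_prob \<pi> T (v @ [y]) = chain_prob \<pi> T v * pmf (T (last v)) y"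
  by (cases v) (auto simp: path_prob_append)

text \<open>Each induction step appends \<open>x\<close> to the reversed word; detailed balance
  turns the new transition out of \<open>y\<close> into a transition into \<open>y\<close> and moves
  the initial weight from \<open>y\<close> to \<open>x\<close>.\<close>

lemma chain_prob_rev:
  assumes "\<And>x y. \<pi> x * pmf (T x) y = \<pi> y * pmf (T' y) x"
  shows "chain_prob \<pi> T (rev v) = chain_prob \<pi> T' v"
proof (induction v)
  case (Cons x v)
  show ?case
  proof (cases v)
    case v: (Cons y v')
    have "chain_prob \<pi> T (rev (x # v)) = chain_prob \<pi> T (rev v) * pmf (T (last (rev v))) x"
      unfolding rev.simps(2) by (rule chain_prob_snoc) (simp add: v)
    also have "\<dots> = chain_prob \<pi> T' v * pmf (T y) x"
      by (simp only: Cons.IH) (simp add: v)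
    also have "\<dots> = chain_prob \<pi> T' (x # v)"
      using assms[of y x] by (simp add: v)
    finally show ?thesis .
  qed simp
qed simp

context markov_process
begin

lemma prob_window':
  "measure M {\<omega> \<in> space M. \<forall>k<length v. \<omega> (a + int k) = v ! k} = chain_prob \<pi> T v"
  using prob_window[of "hd v" "tl v" a] by (cases v) (auto simp: prob_space)

lemma markov_process_reverse:
  assumes balance: "\<And>x y. \<pi> x * pmf (T x) y = \<pi> y * pmf (T' y) x"
  shows "markov_process (reverse_process M) \<pi> T'"
proof -
  have meas: "(\<lambda>\<omega> t. \<omega> (- (t + 1))) \<in> M \<rightarrow>\<^sub>M (path_space :: (int \<Rightarrow> 'a) measure)"
    unfolding measurable_cong_sets[OF sets_M refl]
    by (rule measurable_PiM_single') (auto simp: space_PiM)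
  interpret R: prob_space "reverse_process M"
    unfolding reverse_process_def by (rule prob_space_distr[OF meas])
  show ?thesis
  proof
    show "sets (reverse_process M) = sets path_space"
      by (simp add: reverse_process_def)
    fix a x and v :: "'a list"
    define w where "w = x # v"
    have "{\<omega> \<in> space (path_space :: (int \<Rightarrow> 'a) measure). \<forall>k<length w. \<omega> (a + int k) = w ! k}
        \<in> sets path_space"
      by measurable
    then have win: "{\<omega> \<in> space (reverse_process M). \<forall>k<length w. \<omega> (a + int k) = w ! k} \<in> sets path_space"
      by (simp add: reverse_process_def)
    \<comment> \<open>Reversal sends time \<open>t\<close> to \<open>-(t + 1)\<close>, so the window
      starting at \<open>a\<close> becomes the window starting at \<open>-(a + length w)\<close>,
      read backwards.\<close>
    have *: "(\<forall>k<length w. \<omega> (- (a + int k + 1)) = w ! k) \<longleftrightarrow>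
        (\<forall>k<length (rev w). \<omega> (- (a + int (length w)) + int k) = rev w ! k)" (is "?l \<longleftrightarrow> ?r")
      for \<omega> :: "int \<Rightarrow> 'a"
    proof (intro iffI allI impI)
      fix k assume l: ?l and k: "k < length (rev w)"
      have "- (a + int (length w)) + int k = - (a + int (length w - Suc k) + 1)"
        using k by auto
      then show "\<omega> (- (a + int (length w)) + int k) = rev w ! k"
        using l[rule_format, of "length w - Suc k"] k by (simp only: rev_nth length_rev)
    next
      fix k assume r: ?r and k: "k < length w"
      have *: "- (a + int (length w)) + int (length w - Suc k) = - (a + int k + 1)"
        using k by auto
      show "\<omega> (- (a + int k + 1)) = w ! k"
        using r[rule_format, of "length w - Suc k", unfolded *] k
        by (simp only: rev_nth length_rev) (simp add: Suc_diff_Suc)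
    qed
    have "measure (reverse_process M) {\<omega> \<in> space (reverse_process M). \<forall>k<length w. \<omega> (a + int k) = w ! k}
        = measure M {\<omega> \<in> space M. \<forall>k<length w. \<omega> (- (a + int k + 1)) = w ! k}"
      using win unfolding reverse_process_def
      by (subst measure_distr[OF meas]) (auto intro!: arg_cong[where f = "measure M"] simp: space_PiM)
    also have "\<dots> = chain_prob \<pi> T (rev w)"
      unfolding * by (rule prob_window')
    also have "\<dots> = \<pi> x * path_prob T' x v"
      unfolding chain_prob_rev[OF balance] by (simp add: w_def)
    finally show "measure (reverse_process M)
        {\<omega> \<in> space (reverse_process M). \<forall>k<length (x # v). \<omega> (a + int k) = (x # v) ! k} = \<pi> x * path_prob T' x v"
      by (simp only: w_def)
  qed
qed

end

section \<open>The flower process as a Markov chain\<close>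

text \<open>The events that a word imposes on successive rounds when it starts at an even,
  respectively odd, time; a word ending inside a round constrains only the selected die.\<close>

fun rounds_even :: "nat \<Rightarrow> nat list \<Rightarrow> (nat \<times> nat) set list" where
  "rounds_even n [] = []"
| "rounds_even n [x] = [{r. fst r = x}]"
| "rounds_even n (x # y # v) = {r. fst r = x \<and> snd r + n = y} # rounds_even n v"

fun rounds_odd :: "nat \<Rightarrow> nat list \<Rightarrow> (nat \<times> nat) set list" where
  "rounds_odd n [] = []"
| "rounds_odd n (y # v) = {r. snd r + n = y} # rounds_even n v"

definition symbol_at :: "nat \<Rightarrow> (int \<Rightarrow> nat \<times> nat) \<Rightarrow> int \<Rightarrow> nat" where
  "symbol_at n r u = (if even u then fst (r (u div 2)) else snd (r (u div 2)) + n)"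

lemma all_less_Suc_shift: "(\<forall>k<Suc L. P k) \<longleftrightarrow> P 0 \<and> (\<forall>k<L. P (Suc k))"
  by (auto simp: less_Suc_eq_0_disj)

lemma window_even:
  "(\<forall>k<length v. symbol_at n r (2 * c + int k) = v ! k) \<longleftrightarrow>
   (\<forall>l<length (rounds_even n v). r (c + int l) \<in> rounds_even n v ! l)"
proof (induction n v arbitrary: c rule: rounds_even.induct)
  case (3 n x y v)
  have eq: "2 * c + int (Suc (Suc k)) = 2 * (c + 1) + int k" "c + int (Suc k) = (c + 1) + int k" for k
    by auto
  have "symbol_at n r (2 * c + int (Suc 0)) = snd (r c) + n" "symbol_at n r (2 * c) = fst (r c)"
    by (auto simp: symbol_at_def)
  then show ?case
    using 3[of "c + 1"] by (simp add: all_less_Suc_shift eq del: of_nat_Suc)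
qed (auto simp: symbol_at_def)

lemma window_odd:
  "(\<forall>k<length v. symbol_at n r (2 * c + 1 + int k) = v ! k) \<longleftrightarrow>
   (\<forall>l<length (rounds_odd n v). r (c + int l) \<in> rounds_odd n v ! l)"
proof (cases v)
  case (Cons y v')
  have eq: "2 * c + 1 + int (Suc k) = 2 * (c + 1) + int k" "c + int (Suc k) = (c + 1) + int k" for k
    by auto
  have "symbol_at n r (2 * c + 1) = snd (r c) + n"
    by (auto simp: symbol_at_def)
  then show ?thesis
    using window_even[of v' n r "c + 1"] by (simp add: all_less_Suc_shift eq Cons del: of_nat_Suc)
qed simp

lemma prod_lessThan_length: "(\<Prod>l<length xs. f (xs ! l)) = prod_list (map f xs)"
  by (simp add: prod.list_conv_set_nth atLeast0LessThan)

text \<open>Only finitely many coordinates are constrained, so the infinite product measure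
  factorizes; \<open>nat (i - c)\<close> recovers the list index of coordinate
  \<open>i\<close>.\<close>

lemma emeasure_PiM_window:
  fixes S :: "'b pmf" and c :: int
  shows "emeasure (PiM UNIV (\<lambda>_. measure_pmf S)) {r. \<forall>l<length As. r (c + int l) \<in> As ! l} =
     ennreal (\<Prod>A\<leftarrow>As. measure_pmf.prob S A)"
proof -
  interpret product_prob_space "\<lambda>_::int. measure_pmf S" UNIV ..
  have "{r. \<forall>l<length As. r (c + int l) \<in> As ! l} =
      {r \<in> space (PiM UNIV (\<lambda>_. measure_pmf S)).
         \<forall>i\<in>(\<lambda>l. c + int l) ` {..<length As}. r i \<in> As ! nat (i - c)}"
    by (auto simp: space_PiM)
  then have "emeasure (PiM UNIV (\<lambda>_. measure_pmf S)) {r. \<forall>l<length As. r (c + int l) \<in> As ! l} =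
      (\<Prod>i\<in>(\<lambda>l. c + int l) ` {..<length As}. emeasure (measure_pmf S) (As ! nat (i - c)))"
    by (simp only:) (rule emeasure_PiM_Collect, auto)
  also have "\<dots> = (\<Prod>l<length As. ennreal (measure_pmf.prob S (As ! l)))"
    by (subst prod.reindex) (auto simp: inj_on_def measure_pmf.emeasure_eq_measure)
  also have "\<dots> = ennreal (\<Prod>l<length As. measure_pmf.prob S (As ! l))"
    by (rule prod_ennreal) auto
  finally show ?thesis by (simp add: prod_lessThan_length)
qed

section \<open>Laws of one round and the transition kernel\<close>

definition round_law :: "nat \<Rightarrow> (nat \<Rightarrow> nat pmf) \<Rightarrow> (nat \<times> nat) pmf" where
  "round_law n p = map_pmf (\<lambda>(i, j). (i, j + n)) (select_and_roll n p)"

definition die_law :: "nat \<Rightarrow> nat pmf" where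
  "die_law n = pmf_of_set {1..n}"

definition outcome_law :: "nat \<Rightarrow> (nat \<Rightarrow> nat pmf) \<Rightarrow> nat pmf" where
  "outcome_law n p = map_pmf snd (round_law n p)"

text \<open>The factor one half is the fair coin that chooses between the selecting and the rolling
  phase.\<close>

definition flower_stat :: "nat \<Rightarrow> (nat \<Rightarrow> nat pmf) \<Rightarrow> nat \<Rightarrow> real" where
  "flower_stat n p x = (pmf (die_law n) x + pmf (outcome_law n p) x) / 2"

text \<open>The second branch serves the outcome symbols, which lie above \<open>n\<close>, and is
  also the default for symbols that never occur.\<close>

definition flower_kernel :: "nat \<Rightarrow> (nat \<Rightarrow> nat pmf) \<Rightarrow> nat \<Rightarrow> nat pmf" where
  "flower_kernel n p x = (if x \<in> {1..n} then map_pmf (\<lambda>j. j + n) (p x) else die_law n)"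

locale flower_dice =
  fixes n m :: nat and p :: "nat \<Rightarrow> nat pmf"
  assumes n: "n \<ge> 1" and m: "m \<ge> 2" and dice: "biased_dice n m p"
begin

lemma set_dice: "i \<in> {1..n} \<Longrightarrow> set_pmf (p i) \<subseteq> {1..m}"
  using dice by (auto simp: biased_dice_def)

lemma pmf_die_law: "pmf (die_law n) x = (if x \<in> {1..n} then 1 / n else 0)"
  using n by (simp add: die_law_def pmf_of_set)

lemma set_die_law: "set_pmf (die_law n) = {1..n}"
  using n by (simp add: die_law_def set_pmf_of_set)

lemma pmf_shift: "pmf (map_pmf (\<lambda>j. j + n) q) y = (if y \<ge> n then pmf q (y - n) else 0)"
proof (cases "y \<ge> n")
  case True
  then have "pmf (map_pmf (\<lambda>j. j + n) q) ((y - n) + n) = pmf q (y - n)"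
    by (intro pmf_map_inj') (auto simp: inj_def)
  then show ?thesis using True by simp
next
  case False
  then show ?thesis by (auto simp: pmf_eq_0_set_pmf)
qed

lemma round_law_eq:
  "round_law n p = bind_pmf (die_law n) (\<lambda>i. map_pmf (\<lambda>y. (i, y)) (flower_kernel n p i))"
  unfolding round_law_def select_and_roll_def die_law_def[symmetric] map_bind_pmf
  by (rule bind_pmf_cong) (auto simp: set_die_law flower_kernel_def pmf.map_comp o_def)

lemma fst_round_law: "map_pmf fst (round_law n p) = die_law n"
  unfolding round_law_eq by (simp add: map_bind_pmf pmf.map_comp o_def bind_return_pmf')

lemma pmf_round_law: "pmf (round_law n p) (x, y) = pmf (die_law n) x * pmf (flower_kernel n p x) y"
proof -
  have "pmf (map_pmf (\<lambda>y. (i, y)) (flower_kernel n p i)) (x, y) =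
      indicator {x} i * pmf (flower_kernel n p x) y" for i
    by (cases "i = x") (auto simp: pmf_map_inj' inj_def pmf_eq_0_set_pmf)
  then show ?thesis
    unfolding round_law_eq pmf_bind by (simp add: measure_pmf_single)
qed

lemma set_round_law: "set_pmf (round_law n p) \<subseteq> {1..n} \<times> {n + 1..n + m}"
  using set_dice by (fastforce simp: round_law_eq set_die_law flower_kernel_def)

lemma set_outcome_law: "set_pmf (outcome_law n p) \<subseteq> {n + 1..n + m}"
  using set_round_law by (auto simp: outcome_law_def)

lemma prob_fst: "measure_pmf.prob (select_and_roll n p) {r. fst r = x} = pmf (die_law n) x"
  unfolding fst_round_law[symmetric] round_law_def
  by (simp add: pmf.rep_eq pmf.map_comp vimage_def o_def case_prod_unfold)

lemma prob_snd: "measure_pmf.prob (select_and_roll n p) {r. snd r + n = y} = pmf (outcome_law n p) y"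
  unfolding outcome_law_def round_law_def
  by (simp add: pmf.rep_eq pmf.map_comp vimage_def o_def case_prod_unfold)

lemma prob_round: "measure_pmf.prob (select_and_roll n p) {r. fst r = x \<and> snd r + n = y} =
    pmf (die_law n) x * pmf (flower_kernel n p x) y"
  unfolding pmf_round_law[symmetric] round_law_def
  by (simp add: pmf.rep_eq vimage_def case_prod_unfold)

lemma flower_kernel_select: "x \<notin> {1..n} \<Longrightarrow> flower_kernel n p x = die_law n"
  by (auto simp: flower_kernel_def)

lemma pmf_flower_kernel_low: "x \<in> {1..n} \<Longrightarrow> y \<in> {1..n} \<Longrightarrow> pmf (flower_kernel n p x) y = 0"
  using set_dice[of x] by (auto simp: flower_kernel_def pmf_eq_0_set_pmf)

text \<open>Independent rounds and the Markov chain have to be matched only at the boundary between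
  an outcome and the next selected die.\<close>

lemma prob_rounds_even:
  "(\<Prod>A\<leftarrow>rounds_even n (x # v). measure_pmf.prob (select_and_roll n p) A) =
     pmf (die_law n) x * path_prob (flower_kernel n p) x v"
proof (induction v arbitrary: x rule: induct_list012)
  case 1
  then show ?case by (simp add: prob_fst)
next
  case (2 y)
  then show ?case by (simp add: prob_round)
next
  case (3 y z v)
  \<comment> \<open>If \<open>y\<close> is not a die symbol, its row is \<open>die_law n\<close>. If
    it is one, the product of the two preceding factors vanishes.\<close>
  have "pmf (die_law n) x * pmf (flower_kernel n p x) y * pmf (die_law n) z =
      pmf (die_law n) x * pmf (flower_kernel n p x) y * pmf (flower_kernel n p y) z"
  proof (cases "y \<in> {1..n}")
    case True
    then have "pmf (die_law n) x * pmf (flower_kernel n p x) y = 0"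
      using pmf_flower_kernel_low[of x y] pmf_die_law[of x] by auto
    then show ?thesis by (simp only: mult_zero_left)
  qed (simp add: flower_kernel_select)
  then show ?case using 3(1)[of z] by (simp add: prob_round) auto
qed

lemma prob_rounds_odd:
  "(\<Prod>A\<leftarrow>rounds_odd n (y # v). measure_pmf.prob (select_and_roll n p) A) =
     pmf (outcome_law n p) y * path_prob (flower_kernel n p) y v"
proof (cases v)
  case (Cons z v')
  have "pmf (outcome_law n p) y * pmf (die_law n) z =
      pmf (outcome_law n p) y * pmf (flower_kernel n p y) z"
    using set_outcome_law flower_kernel_select[of y] by (cases "y \<in> {1..n}") (auto simp: pmf_eq_0_set_pmf)
  then show ?thesis
    using prob_rounds_even[of z v'] by (simp add: Cons prob_snd) (auto simp: mult.assoc[symmetric])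
qed (simp add: prob_snd)

section \<open>The law of the whole flower process\<close>

lemma measurable_layout:
  "(\<lambda>(b, r) t. symbol_at n r (t + of_bool b)) \<in>
     measure_pmf (bernoulli_pmf (1/2)) \<Otimes>\<^sub>M PiM (UNIV :: int set) (\<lambda>_. measure_pmf (select_and_roll n p))
     \<rightarrow>\<^sub>M path_space"
proof (rule measurable_PiM_single')
  fix t :: int
  let ?N = "measure_pmf (bernoulli_pmf (1/2)) \<Otimes>\<^sub>M PiM (UNIV :: int set) (\<lambda>_. measure_pmf (select_and_roll n p))"
  \<comment> \<open>For a fixed coin value the symbol at time \<open>t\<close> depends on a single
    round; the coin, having countably many values, is substituted afterwards.\<close>
  have *: "(\<lambda>x. symbol_at n (snd x) (t + of_bool b)) \<in> ?N \<rightarrow>\<^sub>M count_space UNIV" for b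
  proof -
    have "(\<lambda>x. snd x ((t + of_bool b) div 2)) \<in> ?N \<rightarrow>\<^sub>M measure_pmf (select_and_roll n p)"
      by measurable
    then have "(\<lambda>x. g (snd x ((t + of_bool b) div 2))) \<in> ?N \<rightarrow>\<^sub>M count_space UNIV" for g :: "nat \<times> nat \<Rightarrow> nat"
      by (rule measurable_compose) simp
    from this[of fst] this[of "\<lambda>r. snd r + n"] show ?thesis
      unfolding symbol_at_def by (cases "even (t + of_bool b)") (simp_all only: if_True if_False)
  qed
  have "fst \<in> ?N \<rightarrow>\<^sub>M count_space UNIV"
    by (rule measurable_compose[OF measurable_fst]) simp
  from measurable_compose_countable[OF * this]
  show "(\<lambda>x. (case x of (b, r) \<Rightarrow> \<lambda>t. symbol_at n r (t + of_bool b)) t) \<in> ?N \<rightarrow>\<^sub>M count_space UNIV"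
    by (simp add: case_prod_unfold)
qed simp

lemma flower_eq: "flower n p = distr
    (measure_pmf (bernoulli_pmf (1/2)) \<Otimes>\<^sub>M PiM (UNIV :: int set) (\<lambda>_. measure_pmf (select_and_roll n p)))
    path_space (\<lambda>(b, r) t. symbol_at n r (t + of_bool b))"
  unfolding flower_def symbol_at_def Let_def ..

text \<open>Fubini conditions on the coin \<open>b\<close>: the word then starts at the shifted time
  \<open>a + b\<close>, and \<open>window_even\<close> or \<open>window_odd\<close> turns it into
  independent conditions on rounds.\<close>

lemma markov_flower: "markov_process (flower n p) (flower_stat n p) (flower_kernel n p)"
proof -
  let ?B = "measure_pmf (bernoulli_pmf (1/2))"
  let ?Q = "PiM (UNIV :: int set) (\<lambda>_. measure_pmf (select_and_roll n p))"
  let ?f = "\<lambda>(b, r) t. symbol_at n r (t + of_bool b)"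
  interpret Q: product_prob_space "\<lambda>_::int. measure_pmf (select_and_roll n p)" UNIV ..
  interpret BQ: pair_prob_space ?B ?Q ..
  interpret F: prob_space "flower n p"
    unfolding flower_eq by (rule BQ.prob_space_distr[OF measurable_layout])
  show ?thesis
  proof
    show "sets (flower n p) = sets path_space" by (simp add: flower_eq)
    fix a x and v :: "nat list"
    let ?v = "x # v"
    let ?W = "{\<omega> \<in> space (path_space :: (int \<Rightarrow> nat) measure). \<forall>k<length ?v. \<omega> (a + int k) = ?v ! k}"
    have W: "?W \<in> sets path_space" by measurable
    have W': "?f -` ?W \<inter> space (?B \<Otimes>\<^sub>M ?Q) \<in> sets (?B \<Otimes>\<^sub>M ?Q)"
      by (rule measurable_sets[OF measurable_layout W])
    define E where "E u = {r. \<forall>k<length ?v. symbol_at n r (u + int k) = ?v ! k}" for u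
    have E: "emeasure ?Q (E u) = ennreal ((if even u then pmf (die_law n) x else pmf (outcome_law n p) x)
        * path_prob (flower_kernel n p) x v)" for u
    proof (cases "even u")
      case True
      then obtain c where "u = 2 * c" by (elim evenE)
      then show ?thesis
        unfolding E_def by (simp only: window_even emeasure_PiM_window prob_rounds_even) simp
    next
      case False
      then obtain c where "u = 2 * c + 1" by (elim oddE)
      then show ?thesis
        unfolding E_def by (simp only: window_odd emeasure_PiM_window prob_rounds_odd) simp
    qed
    have "Pair b -` (?f -` ?W \<inter> space (?B \<Otimes>\<^sub>M ?Q)) = E (a + of_bool b)" for b
      by (auto simp: E_def space_pair_measure space_PiM algebra_simps)
    then have "emeasure (flower n p) ?W = (\<integral>\<^sup>+b. emeasure ?Q (E (a + of_bool b)) \<partial>?B)"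
      unfolding flower_eq emeasure_distr[OF measurable_layout W]
      by (subst Q.emeasure_pair_measure_alt[OF W']) simp
    also have "\<dots> = emeasure ?Q (E (a + 1)) * ennreal (1/2) + emeasure ?Q (E a) * ennreal (1/2)"
      by simp
    also have "\<dots> = ennreal (flower_stat n p x * path_prob (flower_kernel n p) x v)"
    proof -
      have half: "ennreal u * ennreal (1/2) + ennreal w * ennreal (1/2) = ennreal ((u + w) / 2)"
        if "u \<ge> 0" "w \<ge> 0" for u w :: real
      proof -
        have "ennreal u * ennreal (1/2) = ennreal (u / 2)" "ennreal w * ennreal (1/2) = ennreal (w / 2)"
          by (subst ennreal_mult''[symmetric]; simp)+
        then show ?thesis using that by (simp only: add_divide_distrib) (simp add: ennreal_plus)
      qed
      \<comment> \<open>Exactly one of \<open>a\<close> and \<open>a + 1\<close> is even, so for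
        every \<open>a\<close> the two phases are averaged with equal weight.\<close>
      show ?thesis
        unfolding E by (cases "even a")
          (simp_all add: half path_prob_nonneg flower_stat_def add.commute add_divide_distrib distrib_right del: ennreal_half)
    qed
    finally show "measure (flower n p)
        {\<omega> \<in> space (flower n p). \<forall>k<length ?v. \<omega> (a + int k) = ?v ! k} =
        flower_stat n p x * path_prob (flower_kernel n p) x v"
      by (simp add: measure_def flower_eq flower_stat_def path_prob_nonneg)
  qed
qed

end

section \<open>Quantum models\<close>

lemma idx_enat [simp]: "idx (enat d) = {..<d}"
  by (auto simp: idx_def)

lemma hilb_enat: "hilb (enat d) = {\<psi>. \<forall>i\<ge>d. \<psi> i = 0}"
  by (auto simp: hilb_def not_less)

lemma norm_sq_enat: "norm_sq (enat d) \<psi> = (\<Sum>i<d. (cmod (\<psi> i))\<^sup>2)"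
  by (simp add: norm_sq_def)

lemma qinner_enat: "qinner (enat d) \<phi> \<psi> = (\<Sum>i<d. cnj (\<phi> i) * \<psi> i)"
  by (simp add: qinner_def)

text \<open>Bessel's inequality for a standard basis vector: a single coordinate of its projection
  is bounded by the norm, which gives \<open>s^2 <= s\<close>.\<close>

lemma bessel_coordinate:
  assumes fin: "finite B" and i: "i < d"
    and orth: "\<And>k l. k \<in> B \<Longrightarrow> l \<in> B \<Longrightarrow> qinner (enat d) (e k) (e l) = (if k = l then 1 else 0)"
  shows "(\<Sum>k\<in>B. (cmod (e k i))\<^sup>2) \<le> 1"
proof -
  define s where "s = (\<Sum>k\<in>B. (cmod (e k i))\<^sup>2)"
  \<comment> \<open>\<open>v\<close> is the orthogonal projection of the \<open>i\<close>-th basis vector, so \<open>v i = \<parallel>v\<parallel>\<^sup>2 = s\<close>.\<close>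
  define v where "v j = (\<Sum>k\<in>B. cnj (e k i) * e k j)" for j
  have vi: "v i = of_real s"
    unfolding v_def s_def of_real_sum complex_norm_square by (simp add: mult.commute)
  have "(\<Sum>j<d. of_real ((cmod (v j))\<^sup>2)) =
      (\<Sum>j<d. \<Sum>k\<in>B. \<Sum>l\<in>B. (cnj (e k i) * e l i) * (cnj (e l j) * e k j))"
    unfolding complex_norm_square v_def
    by (simp add: sum_product algebra_simps)
  also have "\<dots> = (\<Sum>k\<in>B. \<Sum>l\<in>B. (cnj (e k i) * e l i) * qinner (enat d) (e l) (e k))"
    unfolding qinner_enat sum_distrib_left
    by (subst sum.swap, rule sum.cong[OF refl], rule sum.swap)
  also have "\<dots> = (\<Sum>k\<in>B. \<Sum>l\<in>B. if l = k then cnj (e k i) * e l i else 0)"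
    by (intro sum.cong refl) (auto simp: orth)
  also have "\<dots> = (of_real s :: complex)"
    unfolding s_def of_real_sum complex_norm_square using fin by (simp add: mult.commute)
  finally have "(\<Sum>j<d. (cmod (v j))\<^sup>2) = s"
    by (simp only: of_real_sum[symmetric] of_real_eq_iff)
  then have "(cmod (v i))\<^sup>2 \<le> s"
    using member_le_sum[of i "{..<d}" "\<lambda>j. (cmod (v j))\<^sup>2"] i by simp
  then have "s\<^sup>2 \<le> s" by (simp add: vi)
  then have "s \<le> 1"
    using mult_strict_left_mono[of 1 s s] by (fastforce simp: power2_eq_square not_less[symmetric])
  then show ?thesis by (simp add: s_def)
qed

text \<open>Double counting of squared entries: each vector contributes exactly 1, each coordinate
  at most 1.\<close>

lemma orthonormal_card_le:
  assumes fin: "finite B"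
    and orth: "\<And>k l. k \<in> B \<Longrightarrow> l \<in> B \<Longrightarrow> qinner (enat d) (e k) (e l) = (if k = l then 1 else 0)"
  shows "card B \<le> d"
proof -
  have "(\<Sum>i<d. (cmod (e k i))\<^sup>2) = 1" if "k \<in> B" for k
  proof -
    have "(\<Sum>i<d. of_real ((cmod (e k i))\<^sup>2)) = (1 :: complex)"
      using orth[OF that that] unfolding qinner_enat complex_norm_square by (simp add: mult.commute)
    then show ?thesis by (simp only: of_real_sum[symmetric] of_real_eq_1_iff)
  qed
  then have "real (card B) = (\<Sum>k\<in>B. \<Sum>i<d. (cmod (e k i))\<^sup>2)" by simp
  also have "\<dots> = (\<Sum>i<d. \<Sum>k\<in>B. (cmod (e k i))\<^sup>2)" by (rule sum.swap)
  also have "\<dots> \<le> (\<Sum>i<d. 1)"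
    using bessel_coordinate[OF fin _ orth] by (intro sum_mono) auto
  finally show ?thesis by simp
qed

text \<open>Orthonormality leaves at most \<open>d\<close> eigenvalues, and the trace condition
  makes them a probability vector, so the entropy bound for finite sets applies.\<close>

lemma spectral_entropy_le:
  assumes dec: "spectral_decomposition (enat d) \<rho> A q e" and trace: "(\<Sum>i<d. \<rho> i i) = 1"
  shows "entropy_sum q A \<le> ereal (log 2 (real d))"
proof -
  have orth: "qinner (enat d) (e k) (e l) = (if k = l then 1 else 0)" if "k \<in> A" "l \<in> A" for k l
    using dec that by (auto simp: spectral_decomposition_def)
  have fin: "finite A"
  proof (rule ccontr)
    assume "infinite A"
    then obtain B where "B \<subseteq> A" "finite B" "card B = Suc d" using infinite_arbitrarily_large by blast
    then show False using orthonormal_card_le[of B d e] orth by (auto simp: subset_iff)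
  qed
  have "(\<Sum>k\<in>A. complex_of_real (q k) * e k i * cnj (e k i)) = \<rho> i i" if "i < d" for i
  proof -
    have "((\<lambda>k. complex_of_real (q k) * e k i * cnj (e k i)) has_sum \<rho> i i) A"
      using dec that by (auto simp: spectral_decomposition_def)
    then show ?thesis using has_sum_finite[OF fin] has_sum_unique by blast
  qed
  then have "1 = (\<Sum>i<d. \<Sum>k\<in>A. complex_of_real (q k) * e k i * cnj (e k i))"
    using trace by simp
  also have "\<dots> = (\<Sum>k\<in>A. complex_of_real (q k) * qinner (enat d) (e k) (e k))"
    unfolding qinner_enat sum_distrib_left by (subst sum.swap) (simp add: algebra_simps)
  also have "\<dots> = complex_of_real (sum q A)" by (simp add: orth)
  finally have "sum q A = 1" by (simp only: of_real_eq_1_iff[symmetric, where 'a=complex])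
  moreover have "q k \<ge> 0" if "k \<in> A" for k
    using dec that by (auto simp: spectral_decomposition_def intro: less_imp_le)
  ultimately show ?thesis
    unfolding entropy_sum_finite[OF fin] ereal_less_eq
    by (intro entropy_le_log_card fin orthonormal_card_le[of A d e] orth)
qed

text \<open>The bound holds for every spectral decomposition, so it holds for the one picked by
  \<open>SOME\<close> as soon as one exists. That existence is the remaining obligation.\<close>

lemma vn_entropy_le:
  assumes "\<exists>A q e. spectral_decomposition (enat d) \<rho> A q e" and "(\<Sum>i<d. \<rho> i i) = 1"
  shows "vn_entropy (enat d) \<rho> \<le> ereal (log 2 (real d))"
proof -
  have "\<exists>A q e. spectral_decomposition (enat d) \<rho> A q e \<and> vn_entropy (enat d) \<rho> = entropy_sum q A"
    unfolding vn_entropy_def by (rule someI_ex) (use assms(1) in blast)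
  then show ?thesis using spectral_entropy_le assms(2) by metis
qed

text \<open>The standard basis spans the range. Since \<open>op_rank\<close> indexes coefficients by
  vectors, \<open>the_inv_into\<close> translates a basis vector back to its index.\<close>

lemma op_rank_le: "op_rank (enat d) \<rho> \<le> enat d"
proof -
  define b :: "nat \<Rightarrow> cvec" where "b k = (\<lambda>i. if i = k then 1 else 0)" for k
  have inj: "inj_on b {..<d}" by (auto simp: inj_on_def b_def fun_eq_iff)
  have "\<exists>c. v = (\<lambda>i. \<Sum>w\<in>b ` {..<d}. c w * w i)" if "v \<in> op_range (enat d) \<rho>" for v
  proof -
    have v: "v i = 0" if "i \<ge> d" for i
      using \<open>v \<in> _\<close> that by (auto simp: op_range_def)
    have *: "v i = (\<Sum>k<d. v (the_inv_into {..<d} b (b k)) * b k i)" for i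
      by (cases "i < d") (simp_all add: the_inv_into_f_f[OF inj] v, simp_all add: b_def if_distrib cong: if_cong)
    show ?thesis
      by (intro exI[of _ "\<lambda>w. v (the_inv_into {..<d} b w)"] ext, subst sum.reindex[OF inj], subst *) simp
  qed
  then have "op_rank (enat d) \<rho> \<le> enat (card (b ` {..<d}))"
    unfolding op_rank_def by (intro INF_lower) auto
  then show ?thesis by (simp add: card_image[OF inj])
qed

section \<open>Explicit diagonalization of a block matrix\<close>

lemma diagonalizing_angle:
  fixes a b c :: real
  obtains \<theta> where "b * ((cos \<theta>)\<^sup>2 - (sin \<theta>)\<^sup>2) = (a - c) * cos \<theta> * sin \<theta>"
proof -
  \<comment> \<open>In doubled angles the condition reads
    \<open>b * cos (2 * \<theta>) = (a - c) / 2 * sin (2 * \<theta>)\<close>, so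
    \<open>2 * \<theta>\<close> may be taken as the argument of \<open>z\<close>.\<close>
  define z where "z = Complex ((a - c) / 2) b"
  define \<theta> where "\<theta> = Arg z / 2"
  have "rcis (cmod z) (2 * \<theta>) = z" by (simp add: \<theta>_def rcis_cmod_Arg)
  then have "(a - c) / 2 = cmod z * cos (2 * \<theta>)" "b = cmod z * sin (2 * \<theta>)"
    by (metis Re_rcis complex.sel(1) z_def, metis Im_rcis complex.sel(2) z_def)
  then have "b * cos (2 * \<theta>) = (a - c) / 2 * sin (2 * \<theta>)" by simp
  then have "b * ((cos \<theta>)\<^sup>2 - (sin \<theta>)\<^sup>2) = (a - c) * cos \<theta> * sin \<theta>"
    by (simp add: cos_double sin_double)
  then show ?thesis by (rule that)
qed

text \<open>The eigenbasis is \<open>(x, y)\<close>, \<open>(- y, x)\<close> with Rayleigh quotients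
  \<open>q1\<close>, \<open>q2\<close>. Each sum equals the wanted entry times
  \<open>(x^2 + y^2)^2\<close> plus a multiple of the off-diagonal defect, which is zero.\<close>

lemma rotated_diagonal:
  fixes a b c x y :: real
  assumes one: "x\<^sup>2 + y\<^sup>2 = 1" and off: "b * (x\<^sup>2 - y\<^sup>2) = (a - c) * x * y"
    and q1: "q1 = x\<^sup>2 * a + 2 * x * y * b + y\<^sup>2 * c" and q2: "q2 = y\<^sup>2 * a - 2 * x * y * b + x\<^sup>2 * c"
  shows "q1 * x * x + q2 * y * y = a" "q1 * x * y - q2 * y * x = b" "q1 * y * y + q2 * x * x = c"
proof -
  have "q1 * x * x + q2 * y * y = a * (x\<^sup>2 + y\<^sup>2)\<^sup>2 + 2 * x * y * (b * (x\<^sup>2 - y\<^sup>2) - (a - c) * x * y)"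
    unfolding q1 q2 by (simp add: power2_eq_square algebra_simps)
  then show "q1 * x * x + q2 * y * y = a" by (simp add: one off)
  have "q1 * x * y - q2 * y * x =
      b * (x\<^sup>2 + y\<^sup>2)\<^sup>2 - (x\<^sup>2 - y\<^sup>2) * (b * (x\<^sup>2 - y\<^sup>2) - (a - c) * x * y)"
    unfolding q1 q2 by (simp add: power2_eq_square algebra_simps)
  then show "q1 * x * y - q2 * y * x = b" by (simp add: one off)
  have "q1 * y * y + q2 * x * x = c * (x\<^sup>2 + y\<^sup>2)\<^sup>2 - 2 * x * y * (b * (x\<^sup>2 - y\<^sup>2) - (a - c) * x * y)"
    unfolding q1 q2 by (simp add: power2_eq_square algebra_simps)
  then show "q1 * y * y + q2 * x * x = c" by (simp add: one off)
qed

lemma sum3: "(\<Sum>i<3. f i) = f 0 + f 1 + f (2::nat)"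
  by (simp add: eval_nat_numeral)

lemma all_less_3: "(\<forall>i<3. P i) \<longleftrightarrow> P 0 \<and> P 1 \<and> P (2::nat)"
  by (auto simp: eval_nat_numeral less_Suc_eq)

text \<open>Index 0 decouples and is its own eigenvector; a plane rotation diagonalizes the block on
  the indices 1 and 2. The rows of \<open>u\<close> form this eigenbasis.\<close>

lemma spectral_decomposition_block:
  fixes r :: "nat \<Rightarrow> nat \<Rightarrow> real"
  assumes \<rho>: "\<And>i j. \<rho> i j = complex_of_real (r i j)"
    and sym: "\<And>i j. r i j = r j i" and block: "r 0 1 = 0" "r 0 2 = 0"
    and psd: "\<And>a. 0 \<le> (\<Sum>i<3. \<Sum>j<3. a i * a j * r i j)"
  shows "\<exists>A q e. spectral_decomposition (enat 3) \<rho> A q e"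
proof -
  obtain \<theta> where \<theta>: "r 1 2 * ((cos \<theta>)\<^sup>2 - (sin \<theta>)\<^sup>2) = (r 1 1 - r 2 2) * cos \<theta> * sin \<theta>"
    by (rule diagonalizing_angle)
  define x y where "x = cos \<theta>" and "y = sin \<theta>"
  have one: "x\<^sup>2 + y\<^sup>2 = 1" by (simp add: x_def y_def)
  define u :: "nat \<Rightarrow> nat \<Rightarrow> real" where
    "u k i = ([[1, 0, 0], [0, x, y], [0, - y, x]] ! k) ! i" for k i
  define q where "q k = (\<Sum>i<3. \<Sum>j<3. u k i * u k j * r i j)" for k
  define e :: "nat \<Rightarrow> cvec" where "e k i = (if i < 3 then of_real (u k i) else 0)" for k i
  \<comment> \<open>A spectral decomposition lists positive eigenvalues only; the remaining ones are
    zero by \<open>psd\<close> and contribute nothing.\<close>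
  define A where "A = {k. k < 3 \<and> q k > 0}"
  have q_nonneg: "q k \<ge> 0" for k unfolding q_def by (rule psd)
  have q: "q 0 = r 0 0" "q 1 = x\<^sup>2 * r 1 1 + 2 * x * y * r 1 2 + y\<^sup>2 * r 2 2"
    "q 2 = y\<^sup>2 * r 1 1 - 2 * x * y * r 1 2 + x\<^sup>2 * r 2 2"
    unfolding q_def u_def using sym[of 1 0] sym[of 2 0] sym[of 2 1] block
    by (simp_all add: sum3 power2_eq_square algebra_simps numeral_2_eq_2)
  note rot = rotated_diagonal[OF one \<theta>[folded x_def y_def] q(2,3)]
  have diag: "\<forall>i<3. \<forall>j<3. (\<Sum>k<3. q k * u k i * u k j) = r i j"
    unfolding all_less_3 sum3 using q(1) rot sym[of 1 0] sym[of 2 0] sym[of 2 1] block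
    by (simp add: u_def numeral_2_eq_2 algebra_simps)
  have orth: "\<forall>k<3. \<forall>l<3. (\<Sum>i<3. u k i * u l i) = (if k = l then 1 else 0)"
    unfolding all_less_3 sum3 using one
    by (simp add: u_def numeral_2_eq_2 power2_eq_square algebra_simps)
  have "qinner (enat 3) (e k) (e l) = (if k = l then 1 else 0)" if "k \<in> A" "l \<in> A" for k l
  proof -
    have "qinner (enat 3) (e k) (e l) = of_real (\<Sum>i<3. u k i * u l i)"
      by (simp add: qinner_enat e_def)
    then show ?thesis using orth that by (simp only:) (auto simp: A_def)
  qed
  moreover have "((\<lambda>k. complex_of_real (q k) * e k i * cnj (e k j)) has_sum \<rho> i j) A"
    if "i < 3" "j < 3" for i j
  proof (rule has_sum_finiteI)
    have "(\<Sum>k\<in>A. complex_of_real (q k) * e k i * cnj (e k j)) =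
        (\<Sum>k<3. complex_of_real (q k) * e k i * cnj (e k j))"
      using q_nonneg by (intro sum.mono_neutral_left) (auto simp: A_def less_le)
    also have "\<dots> = of_real (\<Sum>k<3. q k * u k i * u k j)"
      using that by (simp add: e_def)
    finally show "\<rho> i j = (\<Sum>k\<in>A. complex_of_real (q k) * e k i * cnj (e k j))"
      using diag that by (simp add: \<rho>)
  qed (simp add: A_def)
  ultimately have "spectral_decomposition (enat 3) \<rho> A q e"
    unfolding spectral_decomposition_def by (auto simp: A_def hilb_enat e_def)
  then show ?thesis by blast
qed

section \<open>Sums over outcomes and Kraus indices\<close>

lemma has_sum_pmf: "(pmf p has_sum 1) UNIV"
proof -
  have "Infinite_Sum.abs_summable_on (pmf p) UNIV"
    unfolding abs_summable_equivalent by (rule pmf_abs_summable)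
  then have "pmf p summable_on UNIV" by (rule abs_summable_summable)
  moreover have "infsum (pmf p) UNIV = 1"
    using infsetsum_infsum[OF pmf_abs_summable[of p UNIV]] infsetsum_pmf_eq_1[of p UNIV] by simp
  ultimately show ?thesis by (metis has_sum_infsum)
qed

lemma has_sum_columns:
  fixes g :: "'a \<Rightarrow> nat \<Rightarrow> real"
  assumes "\<And>k. k < d \<Longrightarrow> ((\<lambda>x. g x k) has_sum s k) UNIV" and "\<And>x k. k \<ge> d \<Longrightarrow> g x k = 0"
  shows "((\<lambda>(x, k). g x k) has_sum (\<Sum>k<d. s k)) UNIV"
proof -
  have "((\<lambda>(x, k). g x k) has_sum (\<Sum>k<d. s k)) (UNIV \<times> {..<d})"
    using assms(1)
  proof (induction d)
    case (Suc d)
    have "((\<lambda>(x, k). g x k) has_sum s d) ((\<lambda>x. (x, d)) ` UNIV)"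
      using Suc.prems[of d] by (subst has_sum_reindex) (auto simp: inj_on_def o_def)
    moreover have "((\<lambda>(x, k). g x k) has_sum (\<Sum>k<d. s k)) (UNIV \<times> {..<d})"
      by (rule Suc.IH) (use Suc.prems in auto)
    ultimately have "((\<lambda>(x, k). g x k) has_sum ((\<Sum>k<d. s k) + s d))
        (UNIV \<times> {..<d} \<union> (\<lambda>x. (x, d)) ` UNIV)"
      by (intro has_sum_Un_disjoint) auto
    also have "UNIV \<times> {..<d} \<union> (\<lambda>x. (x, d)) ` UNIV = UNIV \<times> {..<Suc d}" by auto
    finally show ?case by simp
  qed simp
  then show ?thesis
    by (rule has_sum_cong_neutral[THEN iffD1, rotated -1]) (use assms(2) in \<open>auto simp flip: not_less\<close>)
qed

section \<open>Quantum models from latent mixtures\<close>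

context markov_process
begin

lemma measurable_last_symbol: "(\<lambda>h. g (h 0)) \<in> borel_measurable (past_law M)"
proof -
  have "(\<lambda>h :: nat \<Rightarrow> 'a. h 0) \<in> past_law M \<rightarrow>\<^sub>M count_space UNIV"
    unfolding measurable_cong_sets[OF sets_past_law refl] by measurable
  then show ?thesis by (rule measurable_compose) simp
qed

end

text \<open>Read off the latent variable \<open>k\<close> in the computational basis, output \<open>x\<close> with law
  \<open>W k\<close>, and prepare the state of \<open>x\<close>.\<close>

definition mixture_kraus ::
    "('a \<Rightarrow> nat \<Rightarrow> real) \<Rightarrow> (nat \<Rightarrow> 'a pmf) \<Rightarrow> nat \<Rightarrow> 'a \<Rightarrow> nat \<Rightarrow> cvec \<Rightarrow> cvec" where
  "mixture_kraus G W d x k \<psi> =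
     (\<lambda>i. if k < d then of_real (G x i * sqrt (pmf (W k) x)) * \<psi> k else 0)"

text \<open>Here \<open>(G y k)^2\<close> is the probability of the latent value \<open>k\<close>
  given the last symbol \<open>y\<close>. The row identity is demanded only for symbols of positive
  weight, whereas unit norm holds for every symbol, so that the instrument preserves the
  trace.\<close>

locale latent_mixture = markov_process +
  fixes d :: nat and G :: "'a::countable \<Rightarrow> nat \<Rightarrow> real" and W :: "nat \<Rightarrow> 'a pmf"
  assumes G_support: "\<And>x i. i \<ge> d \<Longrightarrow> G x i = 0"
    and G_unit: "\<And>x. (\<Sum>i<d. (G x i)\<^sup>2) = 1"
    and mixture: "\<And>x y. \<pi> y > 0 \<Longrightarrow> pmf (T y) x = (\<Sum>k<d. (G y k)\<^sup>2 * pmf (W k) x)"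
begin

definition memory_vec :: "(nat \<Rightarrow> 'a) \<Rightarrow> cvec" where
  "memory_vec h i = of_real (G (h 0) i)"

lemma norm_sq_kraus:
  "norm_sq (enat d) (mixture_kraus G W d x k \<psi>) = (if k < d then pmf (W k) x * (cmod (\<psi> k))\<^sup>2 else 0)"
proof (cases "k < d")
  case True
  then have "norm_sq (enat d) (mixture_kraus G W d x k \<psi>) =
      (\<Sum>i<d. (G x i)\<^sup>2) * (pmf (W k) x * (cmod (\<psi> k))\<^sup>2)"
    unfolding norm_sq_enat mixture_kraus_def sum_distrib_right
    by (intro sum.cong) (auto simp: norm_mult power_mult_distrib real_sqrt_pow2)
  then show ?thesis using True by (simp add: G_unit)
qed (simp add: norm_sq_enat mixture_kraus_def)

lemma instrument_kraus: "instrument (enat d) (mixture_kraus G W d)"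
  unfolding instrument_def
proof (intro conjI allI ballI)
  fix x k show "linear_op (enat d) (mixture_kraus G W d x k)"
    by (auto simp: linear_op_def hilb_enat mixture_kraus_def G_support fun_eq_iff algebra_simps)
next
  fix \<psi>
  have "((\<lambda>x. pmf (W k) x * (cmod (\<psi> k))\<^sup>2) has_sum 1 * (cmod (\<psi> k))\<^sup>2) UNIV" for k
    by (intro has_sum_cmult_left has_sum_pmf)
  then show "((\<lambda>(x, k). norm_sq (enat d) (mixture_kraus G W d x k \<psi>)) has_sum norm_sq (enat d) \<psi>) UNIV"
    unfolding norm_sq_kraus norm_sq_enat[of d \<psi>] by (intro has_sum_columns) auto
qed

lemma outcome_prob_kraus:
  "outcome_prob (enat d) (mixture_kraus G W d) x \<psi> = (\<Sum>k<d. (cmod (\<psi> k))\<^sup>2 * pmf (W k) x)"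
proof -
  have "outcome_prob (enat d) (mixture_kraus G W d) x \<psi> =
      (\<Sum>\<^sub>\<infinity>k\<in>{..<d}. (cmod (\<psi> k))\<^sup>2 * pmf (W k) x)"
    unfolding outcome_prob_def norm_sq_kraus by (rule infsum_cong_neutral) auto
  then show ?thesis by simp
qed

text \<open>All latent values \<open>k\<close> prepare the same vector, so the state stays pure
  after summing over \<open>k\<close>; the total weight is the outcome probability and
  cancels.\<close>

lemma post_state_kraus:
  assumes "outcome_prob (enat d) (mixture_kraus G W d) x \<psi> > 0"
  shows "post_state (enat d) (mixture_kraus G W d) x \<psi> i j = of_real (G x i * G x j)"
proof -
  have sqrt: "complex_of_real (sqrt (pmf q x)) * complex_of_real (sqrt (pmf q x)) = of_real (pmf q x)" for q
    by (simp flip: of_real_mult)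
  have "(\<Sum>\<^sub>\<infinity>k. mixture_kraus G W d x k \<psi> i * cnj (mixture_kraus G W d x k \<psi> j)) =
      (\<Sum>\<^sub>\<infinity>k\<in>{..<d}. of_real (G x i * G x j) * (of_real ((cmod (\<psi> k))\<^sup>2) * of_real (pmf (W k) x)))"
    unfolding complex_norm_square sqrt[symmetric]
    by (rule infsum_cong_neutral) (auto simp: mixture_kraus_def algebra_simps)
  also have "\<dots> = of_real (G x i * G x j) * of_real (outcome_prob (enat d) (mixture_kraus G W d) x \<psi>)"
    by (simp add: outcome_prob_kraus sum_distrib_left)
  finally show ?thesis using assms by (simp add: post_state_def)
qed

text \<open>The last symbol of \<open>case_nat x h\<close> is \<open>x\<close>, so the vector
  prepared after output \<open>x\<close> encodes the extended past.\<close>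

lemma quantum_model_mixture:
  "quantum_model M (enat d) memory_vec {\<psi> \<in> hilb (enat d). norm_sq (enat d) \<psi> = 1} (mixture_kraus G W d)"
  unfolding quantum_model_def
proof (intro conjI ballI allI impI)
  fix h assume h: "h \<in> pasts M"
  show "memory_vec h \<in> {\<psi> \<in> hilb (enat d). norm_sq (enat d) \<psi> = 1}"
    by (simp add: memory_vec_def hilb_enat norm_sq_enat G_support G_unit)
  fix x
  show prob: "outcome_prob (enat d) (mixture_kraus G W d) x (memory_vec h) = future_prob M h [x]"
    using mixture[OF initial_pos[OF h], of x]
    by (simp add: outcome_prob_kraus future_prob_eq[OF h] memory_vec_def)
  fix i j assume "future_prob M h [x] > 0"
  then show "post_state (enat d) (mixture_kraus G W d) x (memory_vec h) i j =
      memory_vec (case_nat x h) i * cnj (memory_vec (case_nat x h) j)"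
    by (subst post_state_kraus) (simp_all add: prob memory_vec_def)
next
  fix i show "(\<lambda>h. memory_vec h i) \<in> borel_measurable (past_law M)"
    unfolding memory_vec_def by (rule measurable_last_symbol)
qed (simp_all add: instrument_kraus)

section \<open>The average memory state\<close>

definition gram :: "nat \<Rightarrow> nat \<Rightarrow> real" where
  "gram i j = (LINT h|past_law M. G (h 0) i * G (h 0) j)"

lemma memory_state_eq: "memory_state M memory_vec i j = of_real (gram i j)"
  unfolding memory_state_def memory_vec_def gram_def
  by (simp flip: of_real_mult)

lemma abs_G_le_1: "\<bar>G x i\<bar> \<le> 1"
proof (cases "i < d")
  case True
  then have "(G x i)\<^sup>2 \<le> 1"
    using member_le_sum[of i "{..<d}" "\<lambda>i. (G x i)\<^sup>2"] G_unit[of x] by simp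
  then show ?thesis by (simp add: abs_square_le_1)
qed (simp add: G_support)

lemma integrable_gram: "integrable (past_law M) (\<lambda>h. G (h 0) i * G (h 0) j)"
proof (rule past.integrable_const_bound[where B = 1])
  show "AE h in past_law M. norm (G (h 0) i * G (h 0) j) \<le> 1"
    using abs_G_le_1 by (auto simp: abs_mult intro!: mult_le_one)
qed (rule measurable_last_symbol)

text \<open>The quadratic form is the expectation of a square.\<close>

lemma gram_psd: "0 \<le> (\<Sum>i<N. \<Sum>j<N. a i * a j * gram i j)"
proof -
  have "0 \<le> (LINT h|past_law M. (\<Sum>i<N. a i * G (h 0) i)\<^sup>2)" by simp
  also have "\<dots> = (LINT h|past_law M. (\<Sum>i<N. \<Sum>j<N. a i * a j * (G (h 0) i * G (h 0) j)))"
    unfolding power2_eq_square sum_product by (simp add: mult_ac)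
  also have "\<dots> = (\<Sum>i<N. \<Sum>j<N. a i * a j * gram i j)"
    by (simp add: gram_def integrable_gram)
  finally show ?thesis .
qed

lemma gram_trace: "(\<Sum>i<d. gram i i) = 1"
proof -
  have "(\<Sum>i<d. gram i i) = (LINT h|past_law M. (\<Sum>i<d. (G (h 0) i)\<^sup>2))"
    using integrable_gram by (simp add: gram_def power2_eq_square)
  then show ?thesis by (simp add: G_unit past.prob_space)
qed

lemma D_q_le: "D_q M \<le> ereal (log 2 (real d))"
proof -
  have "D_q M \<le> elog2 (op_rank (enat d) (memory_state M memory_vec))"
    unfolding D_q_def using quantum_model_mixture by (intro Inf_lower) blast
  also have "\<dots> \<le> elog2 (enat d)" by (intro elog2_mono op_rank_le)
  finally show ?thesis by (simp add: elog2_def)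
qed

lemma C_q_le:
  assumes "\<exists>A q e. spectral_decomposition (enat d) (memory_state M memory_vec) A q e"
  shows "C_q M \<le> ereal (log 2 (real d))"
proof -
  have "C_q M \<le> vn_entropy (enat d) (memory_state M memory_vec)"
    unfolding C_q_def using quantum_model_mixture by (intro Inf_lower) blast
  also have "\<dots> \<le> ereal (log 2 (real d))"
    using gram_trace by (intro vn_entropy_le assms) (simp add: memory_state_eq flip: of_real_sum)
  finally show ?thesis .
qed

text \<open>No amplitude vector mixes level 0 with levels 1 and 2, so the corresponding entries of
  the memory state are integrals of zero and the explicit diagonalization applies.\<close>

lemma C_q_le_block:
  assumes "d = 3" "\<And>x. G x 0 = 0 \<or> G x 1 = 0 \<and> G x 2 = 0"
  shows "C_q M \<le> ereal (log 2 (real d))"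
proof (rule C_q_le)
  have prod: "G x 0 * G x 1 = 0" "G x 0 * G x 2 = 0" for x
    using assms(2)[of x] by (blast intro: mult_eq_0_iff[THEN iffD2])+
  have "gram 0 1 = 0" "gram 0 2 = 0"
    by (simp_all only: gram_def prod integral_zero)
  moreover have "gram i j = gram j i" for i j
    unfolding gram_def mult.commute[of "G _ i"] by (rule refl)
  ultimately have "\<exists>A q e. spectral_decomposition (enat 3) (memory_state M memory_vec) A q e"
    by (intro spectral_decomposition_block[where r = gram] memory_state_eq gram_psd)
  then show "\<exists>A q e. spectral_decomposition (enat d) (memory_state M memory_vec) A q e"
    unfolding assms(1) .
qed

end

section \<open>Complexities of the flower process\<close>

text \<open>The value \<open>die_law n\<close> is arbitrary: it is used only for outcomes of probability zero.\<close>

definition reverse_flower_kernel :: "nat \<Rightarrow> (nat \<Rightarrow> nat pmf) \<Rightarrow> nat \<Rightarrow> nat pmf" where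
  "reverse_flower_kernel n p y =
    (if y \<in> {1..n} then outcome_law n p
     else if y \<in> set_pmf (outcome_law n p) then map_pmf fst (cond_pmf (round_law n p) {r. snd r = y})
     else die_law n)"

section \<open>Detailed balance for the reversed chain\<close>

context flower_dice
begin

lemma pmf_outcome_law_low: "x \<in> {1..n} \<Longrightarrow> pmf (outcome_law n p) x = 0"
  using set_outcome_law by (auto simp: pmf_eq_0_set_pmf)

lemma flower_stat_low: "x \<in> {1..n} \<Longrightarrow> flower_stat n p x = 1 / (2 * real n)"
  by (simp add: flower_stat_def pmf_outcome_law_low pmf_die_law)

lemma flower_stat_high: "x \<notin> {1..n} \<Longrightarrow> flower_stat n p x = pmf (outcome_law n p) x / 2"
  by (simp add: flower_stat_def pmf_die_law)

lemma flower_support: "{x. flower_stat n p x > 0} = {1..n} \<union> set_pmf (outcome_law n p)"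
proof -
  have "flower_stat n p x > 0 \<longleftrightarrow> x \<in> {1..n} \<or> x \<in> set_pmf (outcome_law n p)" for x
    by (cases "x \<in> {1..n}") (use n in \<open>auto simp: flower_stat_low flower_stat_high pmf_positive_iff\<close>)
  then show ?thesis by blast
qed

text \<open>Bayes' rule: the reversed row of an outcome is the conditional law of the die that
  produced it.\<close>

lemma outcome_reverse_kernel:
  assumes y: "y \<notin> {1..n}"
  shows "pmf (outcome_law n p) y * pmf (reverse_flower_kernel n p y) x = pmf (round_law n p) (x, y)"
proof (cases "y \<in> set_pmf (outcome_law n p)")
  case True
  let ?C = "cond_pmf (round_law n p) {r. snd r = y}"
  have ne: "set_pmf (round_law n p) \<inter> {r. snd r = y} \<noteq> {}"
    using True by (auto simp: outcome_law_def)
  have marg: "measure_pmf.prob (round_law n p) {r. snd r = y} = pmf (outcome_law n p) y"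
    by (simp add: outcome_law_def pmf.rep_eq vimage_def)
  have "pmf (map_pmf fst ?C) x = pmf ?C (x, y)"
  proof (cases "(x, y) \<in> set_pmf ?C")
    case xy: True
    \<comment> \<open>Conditioning fixes the second component, so projecting to the die loses no
      information.\<close>
    have "inj_on fst (set_pmf ?C)" using ne by (auto simp: inj_on_def set_cond_pmf)
    from pmf_map_inj[OF this xy] show ?thesis by simp
  next
    case False
    then have "x \<notin> set_pmf (map_pmf fst ?C)" using ne by (auto simp: set_cond_pmf)
    then show ?thesis using False by (metis pmf_eq_0_set_pmf)
  qed
  also have "\<dots> = pmf (round_law n p) (x, y) / pmf (outcome_law n p) y"
    by (simp add: pmf_cond[OF ne] marg)
  finally have "pmf (reverse_flower_kernel n p y) x = pmf (round_law n p) (x, y) / pmf (outcome_law n p) y"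
    using True y by (auto simp: reverse_flower_kernel_def)
  then show ?thesis using True by (simp add: set_pmf_iff)
next
  case False
  then have "(x, y) \<notin> set_pmf (round_law n p)" by (force simp: outcome_law_def)
  then show ?thesis using False by (simp add: pmf_eq_0_set_pmf[THEN iffD2])
qed

text \<open>If \<open>y\<close> is a die, the previous outcome is independent of it and both sides
  are half the product of the marginals. Otherwise both sides are half the probability of the round
  \<open>(x, y)\<close>.\<close>

lemma flower_balance:
  "flower_stat n p x * pmf (flower_kernel n p x) y = flower_stat n p y * pmf (reverse_flower_kernel n p y) x"
proof (cases "y \<in> {1..n}")
  case y: True
  then have rev: "reverse_flower_kernel n p y = outcome_law n p"
    by (simp add: reverse_flower_kernel_def)
  show ?thesis
  proof (cases "x \<in> {1..n}")
    case True
    then show ?thesis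
      using y by (simp only: rev pmf_flower_kernel_low pmf_outcome_law_low mult_zero_right)
  next
    case False
    then show ?thesis
      using y by (simp add: rev flower_kernel_select flower_stat_high flower_stat_low pmf_die_law del: atLeastAtMost_iff)
  qed
next
  case False
  then have "flower_stat n p y * pmf (reverse_flower_kernel n p y) x =
      pmf (die_law n) x * pmf (flower_kernel n p x) y / 2"
    using outcome_reverse_kernel[of y x] pmf_round_law by (simp add: flower_stat_high del: atLeastAtMost_iff)
  then show ?thesis
    using False by (cases "x \<in> {1..n}")
      (simp_all add: flower_kernel_select flower_stat_high flower_stat_low pmf_die_law del: atLeastAtMost_iff)
qed

sublocale fwd: markov_process "flower n p" "flower_stat n p" "flower_kernel n p"
  by (rule markov_flower)

sublocale bwd: markov_process "reverse_process (flower n p)" "flower_stat n p" "reverse_flower_kernel n p"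
  by (rule fwd.markov_process_reverse) (rule flower_balance)

section \<open>Classical complexities\<close>

lemma inj_flower_kernel: "inj_on (flower_kernel n p) {1..n}"
proof (rule inj_onI, rule ccontr)
  fix i k assume ik: "i \<in> {1..n}" "k \<in> {1..n}" "i \<noteq> k" and eq: "flower_kernel n p i = flower_kernel n p k"
  then obtain j where "pmf (p i) j \<noteq> pmf (p k) j"
    using dice unfolding biased_dice_def by blast
  moreover have "pmf (flower_kernel n p l) (j + n) = pmf (p l) j" if "l \<in> {1..n}" for l
    using that by (simp add: flower_kernel_def pmf_shift)
  ultimately show False using ik eq by metis
qed

lemma die_law_not_kernel: "die_law n \<notin> flower_kernel n p ` {1..n}"
proof
  assume "die_law n \<in> flower_kernel n p ` {1..n}"
  then obtain i where i: "i \<in> {1..n}" "die_law n = flower_kernel n p i" by auto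
  then have "pmf (die_law n) 1 = 0" using pmf_flower_kernel_low[of i 1] n by simp
  then show False using n by (simp add: pmf_die_law)
qed

text \<open>All outcomes share the uniform row, and some outcome has positive probability; together
  with the pairwise distinct die rows this makes \<open>n + 1\<close> rows.\<close>

lemma kernel_image: "flower_kernel n p ` {x. flower_stat n p x > 0} =
    insert (die_law n) (flower_kernel n p ` {1..n})"
proof -
  have "flower_kernel n p ` set_pmf (outcome_law n p) = (\<lambda>_. die_law n) ` set_pmf (outcome_law n p)"
    using set_outcome_law by (intro image_cong) (auto simp: flower_kernel_def)
  also have "\<dots> = {die_law n}" using set_pmf_not_empty[of "outcome_law n p"] by auto
  finally show ?thesis by (simp add: flower_support image_Un)
qed

lemma D_mu_flower: "D_mu (flower n p) = ereal (log 2 (real n + 1))"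
proof -
  have "card (causal_states (flower n p)) = n + 1"
    unfolding fwd.causal_states_eq card_image[OF fwd.inj_state_of] unfolding kernel_image
    using die_law_not_kernel by (simp add: card_image[OF inj_flower_kernel] del: One_nat_def)
  moreover from this have "finite (causal_states (flower n p))" by (intro card_ge_0_finite) simp
  ultimately show ?thesis by (simp add: D_mu_def elog2_def add.commute)
qed

text \<open>Each die state has weight \<open>1 / (2 * n)\<close> and the common outcome state has
  weight 1/2, so the entropy is \<open>1/2 + 1/2 * log 2 (2 * n)\<close>.\<close>

lemma C_mu_flower: "C_mu (flower n p) = ereal (1 + 1/2 * log 2 (real n))"
proof -
  let ?T = "flower_kernel n p" and ?w = "\<lambda>\<kappa>. measure (past_law (flower n p)) (fwd.state_of \<kappa>)"
  have fin: "finite (causal_states (flower n p))"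
    unfolding fwd.causal_states_eq kernel_image by simp
  have sum_states: "(\<Sum>A\<in>causal_states (flower n p). g (measure (past_law (flower n p)) A)) =
      g (?w (die_law n)) + (\<Sum>i\<in>{1..n}. g (?w (?T i)))" for g :: "real \<Rightarrow> real"
    unfolding fwd.causal_states_eq sum.reindex[OF fwd.inj_state_of] unfolding kernel_image
    using die_law_not_kernel by (simp add: sum.reindex[OF inj_flower_kernel] del: One_nat_def)
  have w: "?w (?T i) = 1 / (2 * real n)" if i: "i \<in> {1..n}" for i
  proof -
    \<comment> \<open>No other symbol has the row of die \<open>i\<close>, so its causal state
      consists of the pasts ending in \<open>i\<close>.\<close>
    have "h 0 = i" if "?T (h 0) = ?T i" for h :: "nat \<Rightarrow> nat"
      using that i inj_flower_kernel die_law_not_kernel flower_kernel_select[of "h 0"]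
      by (metis image_eqI inj_onD)
    then have "fwd.state_of (?T i) = {h \<in> pasts (flower n p). h 0 = i}"
      unfolding fwd.state_of_def by auto
    then show ?thesis by (simp add: fwd.measure_past_symbol flower_stat_low[OF i])
  qed
  \<comment> \<open>The weight of the merged outcome state follows by complement.\<close>
  have "?w (die_law n) + (\<Sum>i\<in>{1..n}. ?w (?T i)) = 1"
    using sum_states[of "\<lambda>x. x"] fwd.sum_causal_states[OF fin] by simp
  moreover have "(\<Sum>i\<in>{1..n}. ?w (?T i)) = 1 / 2"
    using n by (simp add: w del: atLeastAtMost_iff)
  ultimately have w0: "?w (die_law n) = 1 / 2" by simp
  have "(\<Sum>i\<in>{1..n}. - (?w (?T i) * log 2 (?w (?T i)))) = 1 / 2 * (1 + log 2 (real n))"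
    using n by (simp add: w log_divide log_mult field_simps del: atLeastAtMost_iff)
  then show ?thesis
    unfolding fwd.C_mu_eq[OF fin]
    using sum_states[of "\<lambda>x. - (x * log 2 x)"] by (simp add: w0 log_divide algebra_simps)
qed

text \<open>Looking backwards, what precedes a die is an outcome independent of it, so all dice
  share one row; the outcomes add at most \<open>m\<close> more. Rows may coincide, so only an
  inclusion is claimed.\<close>

lemma reverse_kernel_image:
  "reverse_flower_kernel n p ` {x. flower_stat n p x > 0} \<subseteq>
     insert (outcome_law n p) (reverse_flower_kernel n p ` {n + 1..n + m})"
  unfolding flower_support using set_outcome_law by (auto simp: reverse_flower_kernel_def)

lemma mu_reverse_flower:
  "C_mu (reverse_process (flower n p)) \<le> ereal (log 2 (real m + 1))"
  "D_mu (reverse_process (flower n p)) \<le> ereal (log 2 (real m + 1))"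
proof -
  let ?S = "reverse_flower_kernel n p ` {x. flower_stat n p x > 0}"
  have fin: "finite ?S" by (rule finite_subset[OF reverse_kernel_image]) simp
  have "card ?S \<le> card (insert (outcome_law n p) (reverse_flower_kernel n p ` {n + 1..n + m}))"
    by (rule card_mono[OF _ reverse_kernel_image]) simp
  also have "\<dots> \<le> Suc (card (reverse_flower_kernel n p ` {n + 1..n + m}))"
    by (simp add: card_insert_if)
  also have "\<dots> \<le> Suc m" using card_image_le[of "{n + 1..n + m}" "reverse_flower_kernel n p"] by simp
  finally have card: "card ?S \<le> Suc m" .
  show "C_mu (reverse_process (flower n p)) \<le> ereal (log 2 (real m + 1))"
    "D_mu (reverse_process (flower n p)) \<le> ereal (log 2 (real m + 1))"
    using bwd.C_mu_le_log[OF fin card] by (simp_all add: add.commute)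
qed

end

section \<open>Three-dimensional quantum models for coins\<close>

definition coin_amplitude :: "nat \<Rightarrow> (nat \<Rightarrow> nat pmf) \<Rightarrow> nat \<Rightarrow> nat \<Rightarrow> real" where
  "coin_amplitude n p x k =
    (if x \<in> {1..n} then if k \<in> {1, 2} then sqrt (pmf (p x) k) else 0 else of_bool (k = 0))"

text \<open>Basis vectors only: outcomes \<open>n + 1\<close>, \<open>n + 2\<close> use levels 1 and
  2, while dice and all remaining symbols use level 0.\<close>

definition outcome_amplitude :: "nat \<Rightarrow> nat \<Rightarrow> nat \<Rightarrow> real" where
  "outcome_amplitude n x k = of_bool (k = (if x \<in> {n + 1, n + 2} then x - n else 0))"

context flower_dice
begin

text \<open>The square roots of the biases place all \<open>n\<close> die states in the plane of
  levels 1 and 2, where level \<open>k\<close> emits \<open>n + k\<close>; level 0 stands for any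
  outcome and emits a uniform die. The non-orthogonality of the die states is what keeps the
  dimension independent of \<open>n\<close>.\<close>

lemma quantum_flower:
  assumes m2: "m = 2"
  shows "C_q (flower n p) \<le> ereal (log 2 3)" "D_q (flower n p) \<le> ereal (log 2 3)"
proof -
  let ?W = "\<lambda>k. if k = 0 then die_law n else return_pmf (n + k)"
  have two: "pmf (p x) 1 + pmf (p x) 2 = 1" "\<And>j. j \<notin> {1, 2} \<Longrightarrow> pmf (p x) j = 0" if "x \<in> {1..n}" for x
  proof -
    have "{1..m} = {1, 2}" using m2 by auto
    then have sub: "set_pmf (p x) \<subseteq> {1, 2}" using set_dice[OF that] by simp
    show "pmf (p x) 1 + pmf (p x) 2 = 1" using sum_pmf_eq_1[of "{1, 2}" "p x"] sub by simp
    show "pmf (p x) j = 0" if "j \<notin> {1, 2}" for j using sub that by (auto simp: pmf_eq_0_set_pmf)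
  qed
  interpret Q: latent_mixture "flower n p" "flower_stat n p" "flower_kernel n p" 3 "coin_amplitude n p" ?W
  proof
    fix x
    show "coin_amplitude n p x i = 0" if "i \<ge> 3" for i
      using that by (auto simp: coin_amplitude_def)
    show "(\<Sum>i<3. (coin_amplitude n p x i)\<^sup>2) = 1"
      using two(1)[of x] by (auto simp: sum3 coin_amplitude_def)
  next
    fix x y
    show "pmf (flower_kernel n p y) x = (\<Sum>k<3. (coin_amplitude n p y k)\<^sup>2 * pmf (?W k) x)"
    proof (cases "y \<in> {1..n}")
      case True
      have "pmf (flower_kernel n p y) x = (if x \<ge> n then pmf (p y) (x - n) else 0)"
        using True by (simp add: flower_kernel_def pmf_shift)
      also have "\<dots> = pmf (p y) 1 * of_bool (x = n + 1) + pmf (p y) 2 * of_bool (x = n + 2)"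
      proof (cases "x \<ge> n")
        case ge: True
        then obtain j where "x = n + j" using le_Suc_ex by blast
        then show ?thesis using two(2)[OF True, of j] by (cases "j \<in> {1, 2}") auto
      qed auto
      finally show ?thesis
        using True by (auto simp: sum3 coin_amplitude_def)
    next
      case False
      then show ?thesis by (auto simp: sum3 coin_amplitude_def flower_kernel_def)
    qed
  qed
  show "D_q (flower n p) \<le> ereal (log 2 3)" using Q.D_q_le by simp
  have "C_q (flower n p) \<le> ereal (log 2 (real 3))"
    by (rule Q.C_q_le_block) (auto simp: coin_amplitude_def)
  then show "C_q (flower n p) \<le> ereal (log 2 3)" by simp
qed

text \<open>Backwards at most three rows occur, so storing the row in orthogonal basis vectors
  already suffices.\<close>

lemma quantum_reverse_flower:
  assumes m2: "m = 2"
  shows "C_q (reverse_process (flower n p)) \<le> ereal (log 2 3)"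
    "D_q (reverse_process (flower n p)) \<le> ereal (log 2 3)"
proof -
  let ?W = "\<lambda>k. if k = 0 then outcome_law n p else reverse_flower_kernel n p (n + k)"
  interpret Q: latent_mixture "reverse_process (flower n p)" "flower_stat n p" "reverse_flower_kernel n p"
    3 "outcome_amplitude n" ?W
  proof
    fix x
    show "outcome_amplitude n x i = 0" if "i \<ge> 3" for i
      using that by (auto simp: outcome_amplitude_def)
    show "(\<Sum>i<3. (outcome_amplitude n x i)\<^sup>2) = 1"
      by (auto simp: sum3 outcome_amplitude_def)
  next
    \<comment> \<open>Positive weight excludes symbols such as 0, whose default row differs from the
      one emitted at level 0.\<close>
    fix x y assume "flower_stat n p y > 0"
    then have "y \<in> {1..n} \<union> set_pmf (outcome_law n p)"
      using flower_support by blast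
    then have "y \<in> {1..n} \<or> y = n + 1 \<or> y = n + 2"
      using set_outcome_law m2 by force
    then show "pmf (reverse_flower_kernel n p y) x = (\<Sum>k<3. (outcome_amplitude n y k)\<^sup>2 * pmf (?W k) x)"
      by (elim disjE) (simp_all add: sum3 outcome_amplitude_def reverse_flower_kernel_def)
  qed
  show "D_q (reverse_process (flower n p)) \<le> ereal (log 2 3)" using Q.D_q_le by simp
  have "C_q (reverse_process (flower n p)) \<le> ereal (log 2 (real 3))"
    by (rule Q.C_q_le_block) (auto simp: outcome_amplitude_def)
  then show "C_q (reverse_process (flower n p)) \<le> ereal (log 2 3)" by simp
qed

end

section \<open>Divergence for growing numbers of dice\<close>

lemma tendsto_infinity_gap:
  fixes a b :: "nat \<Rightarrow> ereal"
  assumes bounds: "\<forall>\<^sub>F k in sequentially. 0 \<le> a k \<and> a k \<le> ereal B"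
    and lim: "b \<longlonglongrightarrow> \<infinity>"
  shows "(\<lambda>k. \<bar>a k - b k\<bar>) \<longlonglongrightarrow> \<infinity>"
  unfolding tendsto_PInfty
proof
  fix r
  \<comment> \<open>Beyond this threshold \<open>b k\<close> exceeds \<open>a k\<close>, which is
    finite and at most \<open>B\<close>, so the absolute difference is larger than
    \<open>r\<close>.\<close>
  from lim have "\<forall>\<^sub>F k in sequentially. ereal (B + max r 0) < b k"
    unfolding tendsto_PInfty by blast
  with bounds show "\<forall>\<^sub>F k in sequentially. ereal r < \<bar>a k - b k\<bar>"
  proof eventually_elim
    case (elim k)
    then show ?case by (cases "a k"; cases "b k") auto
  qed
qed

text \<open>The forward values tend to infinity by their closed forms, while the reversed ones stay
  between 0 and \<open>log 2 (m + 1)\<close>.\<close>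

lemma flower_divergence:
  assumes "\<forall>n\<ge>1. biased_dice n m (P n)" and m: "m \<ge> 2"
  shows "(\<lambda>n. C_mu (flower n (P n))) \<longlonglongrightarrow> \<infinity>"
    and "(\<lambda>n. D_mu (flower n (P n))) \<longlonglongrightarrow> \<infinity>"
    and "(\<lambda>n. \<bar>C_mu (reverse_process (flower n (P n))) - C_mu (flower n (P n))\<bar>) \<longlonglongrightarrow> \<infinity>"
    and "(\<lambda>n. \<bar>D_mu (reverse_process (flower n (P n))) - D_mu (flower n (P n))\<bar>) \<longlonglongrightarrow> \<infinity>"
proof -
  \<comment> \<open>The closed forms require \<open>n >= 1\<close>, so they are transferred to the
    limits only eventually.\<close>
  have dice: "\<forall>\<^sub>F n in sequentially. flower_dice n m (P n)"
    using eventually_ge_at_top[of "1 :: nat"]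
    by eventually_elim (use assms in \<open>auto simp: flower_dice_def\<close>)
  have "(\<lambda>n. ereal (1 + 1/2 * log 2 (real n))) \<longlonglongrightarrow> \<infinity>"
    unfolding tendsto_PInfty_eq_at_top by real_asymp
  moreover have "\<forall>\<^sub>F n in sequentially. ereal (1 + 1/2 * log 2 (real n)) = C_mu (flower n (P n))"
    using dice by eventually_elim (simp add: flower_dice.C_mu_flower)
  ultimately show C: "(\<lambda>n. C_mu (flower n (P n))) \<longlonglongrightarrow> \<infinity>"
    by (rule Lim_transform_eventually)
  have "(\<lambda>n. ereal (log 2 (real n + 1))) \<longlonglongrightarrow> \<infinity>"
    unfolding tendsto_PInfty_eq_at_top by real_asymp
  moreover have "\<forall>\<^sub>F n in sequentially. ereal (log 2 (real n + 1)) = D_mu (flower n (P n))"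
    using dice by eventually_elim (simp add: flower_dice.D_mu_flower)
  ultimately show D: "(\<lambda>n. D_mu (flower n (P n))) \<longlonglongrightarrow> \<infinity>"
    by (rule Lim_transform_eventually)
  have "\<forall>\<^sub>F n in sequentially. 0 \<le> C_mu (reverse_process (flower n (P n))) \<and>
      C_mu (reverse_process (flower n (P n))) \<le> ereal (log 2 (real m + 1))"
    using dice
  proof eventually_elim
    case (elim n)
    interpret flower_dice n m "P n" by fact
    show ?case using bwd.C_mu_nonneg mu_reverse_flower by simp
  qed
  then show "(\<lambda>n. \<bar>C_mu (reverse_process (flower n (P n))) - C_mu (flower n (P n))\<bar>) \<longlonglongrightarrow> \<infinity>"
    by (rule tendsto_infinity_gap) (rule C)
  have "\<forall>\<^sub>F n in sequentially. 0 \<le> D_mu (reverse_process (flower n (P n))) \<and>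
      D_mu (reverse_process (flower n (P n))) \<le> ereal (log 2 (real m + 1))"
    using dice
  proof eventually_elim
    case (elim n)
    interpret flower_dice n m "P n" by fact
    show ?case using bwd.D_mu_nonneg mu_reverse_flower by simp
  qed
  then show "(\<lambda>n. \<bar>D_mu (reverse_process (flower n (P n))) - D_mu (flower n (P n))\<bar>) \<longlonglongrightarrow> \<infinity>"
    by (rule tendsto_infinity_gap) (rule D)
qed

theorem mainTheorem3:
  shows "(\<forall>(n::nat) (m::nat) p. n \<ge> 1 \<longrightarrow> m \<ge> 2 \<longrightarrow> biased_dice n m p \<longrightarrow>
            C_mu (flower n p) = ereal (1 + 1/2 * log 2 (real n)) \<and>
            C_mu (reverse_process (flower n p)) \<le> ereal (log 2 (real m + 1)) \<and>
            D_mu (flower n p) = ereal (log 2 (real n + 1)) \<and>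
            D_mu (reverse_process (flower n p)) \<le> ereal (log 2 (real m + 1)))
       \<and> (\<forall>P. (\<forall>n\<ge>1. biased_dice n 2 (P n)) \<longrightarrow>
            ((\<lambda>n. C_mu (flower n (P n))) \<longlonglongrightarrow> \<infinity>) \<and>
            ((\<lambda>n. D_mu (flower n (P n))) \<longlonglongrightarrow> \<infinity>) \<and>
            ((\<lambda>n. \<bar>C_mu (reverse_process (flower n (P n))) - C_mu (flower n (P n))\<bar>) \<longlonglongrightarrow> \<infinity>) \<and>
            ((\<lambda>n. \<bar>D_mu (reverse_process (flower n (P n))) - D_mu (flower n (P n))\<bar>) \<longlonglongrightarrow> \<infinity>))
       \<and> (\<forall>(n::nat) p. n \<ge> 1 \<longrightarrow> biased_dice n 2 p \<longrightarrow>
            C_q (flower n p) \<le> ereal (log 2 3) \<and>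
            C_q (reverse_process (flower n p)) \<le> ereal (log 2 3) \<and>
            D_q (flower n p) \<le> ereal (log 2 3) \<and>
            D_q (reverse_process (flower n p)) \<le> ereal (log 2 3))"
proof (rule conjI[OF _ conjI]; intro allI impI)
  fix n m :: nat and p assume "n \<ge> 1" "m \<ge> 2" "biased_dice n m p"
  then interpret flower_dice n m p by unfold_locales
  show "C_mu (flower n p) = ereal (1 + 1/2 * log 2 (real n)) \<and>
      C_mu (reverse_process (flower n p)) \<le> ereal (log 2 (real m + 1)) \<and>
      D_mu (flower n p) = ereal (log 2 (real n + 1)) \<and>
      D_mu (reverse_process (flower n p)) \<le> ereal (log 2 (real m + 1))"
    by (intro conjI C_mu_flower D_mu_flower mu_reverse_flower)
next
  fix P :: "nat \<Rightarrow> nat \<Rightarrow> nat pmf" assume "\<forall>n\<ge>1. biased_dice n 2 (P n)"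
  from flower_divergence[OF this order_refl]
  show "((\<lambda>n. C_mu (flower n (P n))) \<longlonglongrightarrow> \<infinity>) \<and>
      ((\<lambda>n. D_mu (flower n (P n))) \<longlonglongrightarrow> \<infinity>) \<and>
      ((\<lambda>n. \<bar>C_mu (reverse_process (flower n (P n))) - C_mu (flower n (P n))\<bar>) \<longlonglongrightarrow> \<infinity>) \<and>
      ((\<lambda>n. \<bar>D_mu (reverse_process (flower n (P n))) - D_mu (flower n (P n))\<bar>) \<longlonglongrightarrow> \<infinity>)"
    by (intro conjI)
next
  fix n :: nat and p assume "n \<ge> 1" "biased_dice n 2 p"
  then interpret flower_dice n 2 p by unfold_locales simp_all
  show "C_q (flower n p) \<le> ereal (log 2 3) \<and>
      C_q (reverse_process (flower n p)) \<le> ereal (log 2 3) \<and>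
      D_q (flower n p) \<le> ereal (log 2 3) \<and>
      D_q (reverse_process (flower n p)) \<le> ereal (log 2 3)"
    using quantum_flower quantum_reverse_flower by simp
qed

end
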